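(* Let $V$ be an irreducible uniformly bounded weight module for $(\mathcal{S}_N\ltimes A_N)\otimes B$ on which $t^{\mathbf{0}}$ acts non-trivially and $t^{\mathbf{s}}$ acts non-trivially for some $\mathbf{s}\neq\mathbf{0}$. Let $\psi:B\to\mathbb{C}$ be the algebra homomorphism with $t^{\mathbf{r}}b=\psi(b)t^{\mathbf{r}}$ on $V$ for all $\mathbf{r}\ne\mathbf{0}$, $b\in B$. Then for any $v\in V$ and $b\in B$ we have $D(u,\mathbf{r})b\cdot v=\psi(b)D(u,\mathbf{r})\cdot v$ for every $u\in\mathbb{C}^N$ and $\mathbf{r}\in\mathbb{Z}^N\setminus\{\mathbf{0}\}$ with $(u,\mathbf{r})=0$.
   Context: All vector spaces, algebras and tensor products are over $\mathbb{C}$; $B$ is a finitely generated commutative associative unital algebra; $N\ge 2$ is an integer. $A_N=\mathbb{C}[t_1^{\pm1},\dots,t_N^{\pm1}]$, $t^{\mathbf{m}}=t_1^{m_1}\cdots t_N^{m_N}$, $d_i=t_i\frac{d}{dt_i}$, $(x,y)=\sum_ix_iy_i$. For $u\in\mathbb{C}^N$, $\mathbf{r}\in\mathbb{Z}^N$ put $D(u,\mathbf{r})=\sum_iu_it^{\mathbf{r}}d_i$; $\mathcal{S}_N=\mathrm{span}\{D(u,\mathbf{r})\mid(u,\mathbf{r})=0\}$ with $[D(u,\mathbf{r}),D(v,\mathbf{s})]=D((u,\mathbf{s})v-(v,\mathbf{r})u,\mathbf{r}+\mathbf{s})$. In $\mathcal{S}_N\ltimes A_N$, $A_N$ is an abelian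 ideal and $[D(u,\mathbf{r}),t^{\mathbf{s}}]=(u,\mathbf{s})t^{\mathbf{r}+\mathbf{s}}$. For a Lie algebra $\mathfrak{g}$, $\mathfrak{g}\otimes B$ has bracket $[x\otimes b_1,y\otimes b_2]=[x,y]\otimes b_1b_2$; write $xb=x\otimes b$ and $x=x\otimes1$. $\mathfrak{h}=\mathrm{span}\{d_1,\dots,d_N\}$. A uniformly bounded weight module is a module $V=\bigoplus_{\lambda\in\mathfrak{h}^*}V_\lambda$, $V_\lambda=\{v\mid hv=\lambda(h)v\ \forall h\in\mathfrak{h}\}$, for which there is a positive integer $M$ with $\dim V_\lambda\le M$ for all $\lambda$. Under the hypotheses of the claim a homomorphism $\psi$ as described exists and is unique. *)

theory Defs
  imports "HOL-Analysis.Analysis" "HOL-Library.Poly_Mapping"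
begin

section \<open>Commutative algebras over the complex numbers\<close>

locale complex_comm_algebra = vector_space scaleB
  for scaleB :: "complex \<Rightarrow> 'b::comm_ring_1 \<Rightarrow> 'b" +
  assumes scale_mult_left: "scaleB c (x * y) = scaleB c x * y"

definition subalgebra :: "(complex \<Rightarrow> 'b::comm_ring_1 \<Rightarrow> 'b) \<Rightarrow> 'b set \<Rightarrow> bool" where
  "subalgebra scaleB A \<longleftrightarrow>
     module.subspace scaleB A \<and> 1 \<in> A \<and> (\<forall>x\<in>A. \<forall>y\<in>A. x * y \<in> A)"

definition finitely_generated_algebra :: "(complex \<Rightarrow> 'b::comm_ring_1 \<Rightarrow> 'b) \<Rightarrow> bool" where
  "finitely_generated_algebra scaleB \<longleftrightarrow>
     (\<exists>S. finite S \<and> (\<forall>A. subalgebra scaleB A \<and> S \<subseteq> A \<longrightarrow> A = UNIV))"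

definition character :: "(complex \<Rightarrow> 'b::comm_ring_1 \<Rightarrow> 'b) \<Rightarrow> ('b \<Rightarrow> complex) \<Rightarrow> bool" where
  "character scaleB \<psi> \<longleftrightarrow> Vector_Spaces.linear scaleB (*) \<psi> \<and>
     \<psi> 1 = 1 \<and> (\<forall>x y. \<psi> (x * y) = \<psi> x * \<psi> y)"

section \<open>Laurent polynomial vector fields\<close>

text \<open>
  Exponents range over \<open>int^'n\<close>, and \<open>Poly_Mapping.single r b\<close> is the monomial \<open>b t^r\<close>.
  Coefficients in a ring \<open>'b\<close> are allowed: \<open>'b = complex\<close> gives \<open>A_N\<close>, and a general \<open>'b\<close>
  gives \<open>A_N\<close> tensored with \<open>'b\<close>.
  A vector field \<open>\<Sum>i. f_i d_i\<close> is stored as its coefficient vector \<open>(\<chi> i. f_i)\<close>.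
  A pair \<open>(X, f)\<close> is the element \<open>X + f\<close> of the semidirect product of vector fields and
  Laurent polynomials.
\<close>

type_synonym ('n, 'b) laurent = "(int^'n) \<Rightarrow>\<^sub>0 'b"
type_synonym ('n, 'b) vfield = "('n, 'b) laurent ^ 'n"
type_synonym ('n, 'b) semidirect = "('n, 'b) vfield \<times> ('n, 'b) laurent"

definition pairing :: "complex^'n \<Rightarrow> int^'n::finite \<Rightarrow> complex" where
  "pairing u r = (\<Sum>i\<in>UNIV. u $ i * of_int (r $ i))"

text \<open>The derivation \<open>t_i d/dt_i\<close>.\<close>

definition euler :: "'n \<Rightarrow> ('n::finite, 'b::comm_ring_1) laurent \<Rightarrow> ('n, 'b) laurent" where
  "euler i f = Poly_Mapping.mapp (\<lambda>r c. of_int (r $ i) * c) f"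

definition apply_vfield ::
    "('n::finite, 'b::comm_ring_1) vfield \<Rightarrow> ('n, 'b) laurent \<Rightarrow> ('n, 'b) laurent" where
  "apply_vfield X f = (\<Sum>i\<in>UNIV. X $ i * euler i f)"

definition bracket ::
    "('n::finite, 'b::comm_ring_1) semidirect \<Rightarrow> ('n, 'b) semidirect \<Rightarrow> ('n, 'b) semidirect" where
  "bracket x y =
     ((\<chi> i. apply_vfield (fst x) (fst y $ i) - apply_vfield (fst y) (fst x $ i)),
      apply_vfield (fst x) (snd y) - apply_vfield (fst y) (snd x))"

definition coeff_map :: "('a::zero \<Rightarrow> 'b::zero) \<Rightarrow> ('n::finite, 'a) semidirect \<Rightarrow> ('n, 'b) semidirect"
  where "coeff_map h x = ((\<chi> i. Poly_Mapping.map h (fst x $ i)), Poly_Mapping.map h (snd x))"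

definition scaleL ::
    "(complex \<Rightarrow> 'b::zero \<Rightarrow> 'b) \<Rightarrow> complex \<Rightarrow> ('n::finite, 'b) semidirect \<Rightarrow> ('n, 'b) semidirect"
  where "scaleL scaleB c = coeff_map (scaleB c)"

definition mono_A :: "int^'n::finite \<Rightarrow> ('n, complex) semidirect" where
  "mono_A r = (0, Poly_Mapping.single r 1)"

definition D :: "complex^'n \<Rightarrow> int^'n::finite \<Rightarrow> ('n, complex) semidirect" where
  "D u r = ((\<chi> i. Poly_Mapping.single r (u $ i)), 0)"

text \<open>The Lie algebra \<open>S_N \<ltimes> A_N\<close>.\<close>

definition SA :: "('n::finite, complex) semidirect set" where
  "SA = module.span (scaleL (*)) ({D u r | u r. pairing u r = 0} \<union> range mono_A)"

text \<open>
  \<open>tens scaleB x b\<close> is the pure tensor of \<open>x\<close> and \<open>b\<close>: every complex coefficient \<open>c\<close> of \<open>x\<close>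
  is replaced by \<open>c b\<close>.  Below, \<open>tens_sum_eq_0D\<close> together with the definition of \<open>SA_tensor\<close>
  as the span of pure tensors shows that \<open>SA_tensor\<close> is a tensor product of \<open>SA\<close> and \<open>'b\<close>,
  and \<open>bracket_tens\<close> shows that its bracket is the one of a current algebra.
\<close>

definition tens ::
    "(complex \<Rightarrow> 'b::zero \<Rightarrow> 'b) \<Rightarrow> ('n::finite, complex) semidirect \<Rightarrow> 'b \<Rightarrow> ('n, 'b) semidirect"
  where "tens scaleB x b = coeff_map (\<lambda>c. scaleB c b) x"

definition SA_tensor ::
    "(complex \<Rightarrow> 'b::comm_ring_1 \<Rightarrow> 'b) \<Rightarrow> ('n::finite, 'b) semidirect set" where
  "SA_tensor scaleB = module.span (scaleL scaleB) {tens scaleB x b | x b. x \<in> SA}"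

subsection \<open>Consistency with the defining relations\<close>

lemma euler_single:
  "euler i (Poly_Mapping.single r c) = Poly_Mapping.single r (of_int (r $ i) * c)"
  by (rule poly_mapping_eqI) (auto simp: euler_def lookup_mapp lookup_single when_def)

lemma euler_0 [simp]: "euler i 0 = 0"
  by (rule poly_mapping_eqI) (auto simp: euler_def lookup_mapp)

lemma apply_vfield_0 [simp]: "apply_vfield X 0 = 0" "apply_vfield 0 f = 0"
  by (simp_all add: apply_vfield_def)

lemma single_sum: "Poly_Mapping.single k (sum g A) = (\<Sum>i\<in>A. Poly_Mapping.single k (g i))"
  by (induction A rule: infinite_finite_induct) (auto simp: single_add)

lemma apply_D:
  "apply_vfield (fst (D u r)) (Poly_Mapping.single s c) =
     Poly_Mapping.single (r + s) (pairing u s * c)"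
  by (simp add: apply_vfield_def D_def euler_single mult_single pairing_def sum_distrib_right
      single_sum mult.assoc)

lemma bracket_D_D:
  fixes u v :: "complex^'n::finite"
  shows "bracket (D u r) (D v s) = D (pairing u s *s v - pairing v r *s u) (r + s)"
proof -
  have "fst (bracket (D u r) (D v s)) $ i =
      fst (D (pairing u s *s v - pairing v r *s u) (r + s)) $ i" for i :: 'n
  proof -
    have "fst (D w q) $ i = Poly_Mapping.single q (w $ i)" for w :: "complex^'n" and q
      by (simp add: D_def)
    then show ?thesis
      by (simp add: bracket_def apply_D single_diff add.commute)
  qed
  moreover have "snd (bracket (D u r) (D v s)) = 0"
    by (simp add: bracket_def) (simp add: D_def)
  ultimately show ?thesis
    by (simp add: prod_eq_iff vec_eq_iff) (simp add: D_def)
qed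

lemma bracket_D_mono: "bracket (D u r) (mono_A s) = (0, Poly_Mapping.single (r + s) (pairing u s))"
  by (simp add: bracket_def mono_A_def apply_D vec_eq_iff)

lemma bracket_A_A: "bracket (0, f) (0, g) = 0"
  by (simp add: bracket_def vec_eq_iff prod_eq_iff)

context complex_comm_algebra
begin

lemma lookup_map_scale:
  "Poly_Mapping.lookup (Poly_Mapping.map (scaleB c) f) k = scaleB c (Poly_Mapping.lookup f k)"
  by (simp add: Poly_Mapping.map.rep_eq when_def)

lemma lookup_map_scale':
  "Poly_Mapping.lookup (Poly_Mapping.map (\<lambda>c. scaleB c b) f) k = scaleB (Poly_Mapping.lookup f k) b"
  by (simp add: Poly_Mapping.map.rep_eq when_def)

lemma vector_space_scaleL: "vector_space (scaleL scaleB)"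
  by unfold_locales
     (auto simp: scaleL_def coeff_map_def prod_eq_iff vec_eq_iff lookup_map_scale lookup_add
        scale_right_distrib scale_left_distrib intro!: poly_mapping_eqI)

lemma tens_add_left: "tens scaleB (x + y) b = tens scaleB x b + tens scaleB y b"
  by (auto simp: tens_def coeff_map_def prod_eq_iff vec_eq_iff lookup_map_scale' lookup_add
        scale_left_distrib intro!: poly_mapping_eqI)

lemma tens_add_right: "tens scaleB x (b + c) = tens scaleB x b + tens scaleB x c"
  by (auto simp: tens_def coeff_map_def prod_eq_iff vec_eq_iff Poly_Mapping.map.rep_eq when_def
        lookup_add scale_right_distrib intro!: poly_mapping_eqI)

lemma tens_scale_left: "tens scaleB (scaleL (*) c x) b = scaleL scaleB c (tens scaleB x b)"
  by (auto simp: tens_def scaleL_def coeff_map_def prod_eq_iff vec_eq_iff lookup_map_scale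
        lookup_map_scale' Poly_Mapping.map.rep_eq when_def intro!: poly_mapping_eqI)

lemma tens_scale_right: "tens scaleB x (scaleB c b) = scaleL scaleB c (tens scaleB x b)"
  by (auto simp: tens_def scaleL_def coeff_map_def prod_eq_iff vec_eq_iff Poly_Mapping.map.rep_eq
        when_def mult.commute intro!: poly_mapping_eqI)

lemma scale_mult_right: "scaleB c (x * y) = x * scaleB c y"
  using scale_mult_left[of c y x] by (simp only: mult.commute)

lemma map_scale_mult:
  "Poly_Mapping.map (\<lambda>c. scaleB c b) f * Poly_Mapping.map (\<lambda>c. scaleB c b') g =
     Poly_Mapping.map (\<lambda>c. scaleB c (b * b')) (f * g :: ('n::finite, complex) laurent)"
proof -
  have add: "Poly_Mapping.map (\<lambda>c. scaleB c d) (p + q) =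
      Poly_Mapping.map (\<lambda>c. scaleB c d) p + Poly_Mapping.map (\<lambda>c. scaleB c d) q"
    for d and p q :: "('n, complex) laurent"
    by (rule poly_mapping_eqI) (simp add: lookup_map_scale' lookup_add scale_left_distrib)
  have zero: "Poly_Mapping.map (\<lambda>c. scaleB c d) 0 = 0" for d
    by (rule poly_mapping_eqI) (simp add: lookup_map_scale')
  have upd: "Poly_Mapping.update a c p = p + Poly_Mapping.single a c"
    if "a \<notin> Poly_Mapping.keys p" for a c and p :: "('n, complex) laurent"
    using that by (intro poly_mapping_eqI)
      (auto simp: Poly_Mapping.update.rep_eq lookup_add lookup_single when_def in_keys_iff)
  have comm: "scaleB c x * scaleB d y = scaleB (c * d) (x * y)" for c d x y
    by (simp only: scale_scale mult.commute[of d c] flip: scale_mult_left scale_mult_right)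
  have single: "Poly_Mapping.map (\<lambda>c. scaleB c b) (Poly_Mapping.single r c) *
      Poly_Mapping.map (\<lambda>c. scaleB c b') g =
      Poly_Mapping.map (\<lambda>c. scaleB c (b * b')) (Poly_Mapping.single r c * g)" for r c
    by (induction g rule: Poly_Mapping.update_induct)
       (simp_all add: zero upd add distrib_left mult_single comm)
  show ?thesis
    by (induction f rule: Poly_Mapping.update_induct)
       (simp_all add: zero upd add distrib_right single del: map_single)
qed

lemma bracket_tens:
  fixes x y :: "('n::finite, complex) semidirect"
  shows "bracket (tens scaleB x b) (tens scaleB y c) = tens scaleB (bracket x y) (b * c)"
proof -
  let ?m = "\<lambda>b. Poly_Mapping.map (\<lambda>c. scaleB c b)"
  have euler: "euler i (?m d f) = ?m d (euler i f)" for i d and f :: "('n, complex) laurent"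
  proof (rule poly_mapping_eqI)
    fix k
    have of_int: "scaleB (of_int z * a) d = of_int z * scaleB a d" for z a
    proof -
      have "scaleB (of_int z * a) d = scaleB (of_int z) 1 * scaleB a d"
        by (simp only: mult_1 scale_scale flip: scale_mult_left)
      moreover have "scaleB (of_int z) 1 = of_int z"
      proof (induction z rule: int_induct[where k = 0])
        case base then show ?case by simp
      next
        case (step1 i) then show ?case by (simp add: scale_left_distrib)
      next
        case (step2 i) then show ?case by (simp add: scale_left_diff_distrib)
      qed
      ultimately show ?thesis by simp
    qed
    show "Poly_Mapping.lookup (euler i (?m d f)) k = Poly_Mapping.lookup (?m d (euler i f)) k"
      by (auto simp: euler_def lookup_mapp lookup_map_scale' of_int when_def in_keys_iff)
  qed
  have sum: "(\<Sum>i\<in>A. ?m d (f i)) = ?m d (\<Sum>i\<in>A. f i)"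
    for d and A :: "'n set" and f :: "'n \<Rightarrow> ('n, complex) laurent"
    by (rule poly_mapping_eqI) (simp add: lookup_map_scale' lookup_sum scale_sum_left)
  have diff: "?m d f - ?m d g = ?m d (f - g)" for d and f g :: "('n, complex) laurent"
    by (rule poly_mapping_eqI) (simp add: lookup_map_scale' lookup_minus scale_left_diff_distrib)
  have app: "apply_vfield (\<chi> i. ?m d (X $ i)) (?m e f) = ?m (d * e) (apply_vfield X f)"
    for d e f and X :: "('n, complex) vfield"
    by (simp only: apply_vfield_def euler map_scale_mult sum vec_lambda_beta)
  show ?thesis
    by (simp only: bracket_def tens_def coeff_map_def fst_conv snd_conv vec_lambda_beta app diff
        mult.commute[of c b])
qed

lemma tens_sum_eq_0D:
  fixes x :: "'i \<Rightarrow> ('n::finite, complex) semidirect"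
  assumes "finite I"
    and indep: "\<And>c. (\<Sum>i\<in>I. scaleL (*) (c i) (x i)) = 0 \<Longrightarrow> \<forall>i\<in>I. c i = 0"
    and sum0: "(\<Sum>i\<in>I. tens scaleB (x i) (b i)) = 0"
  shows "\<forall>i\<in>I. b i = 0"
proof (rule ccontr)
  assume "\<not> ?thesis"
  then obtain j where j: "j \<in> I" "b j \<noteq> 0" by auto
  interpret P: vector_space_pair scaleB "(*) :: complex \<Rightarrow> _"
    by unfold_locales (auto simp: algebra_simps)
  have "independent {b j}" using j by simp
  then obtain g where g: "Vector_Spaces.linear scaleB (*) g" "g (b j) = 1"
    using P.linear_independent_extend[of "{b j}" "\<lambda>_. 1"] by auto
  interpret g: Vector_Spaces.linear scaleB "(*)" g by fact
  have g_sum: "(\<Sum>i\<in>I. g (b i) * h i) = 0" if "(\<Sum>i\<in>I. scaleB (h i) (b i)) = 0" for h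
  proof -
    have "g (\<Sum>i\<in>I. scaleB (h i) (b i)) = 0" using that g.zero by simp
    then show ?thesis by (simp add: g.sum g.scale mult.commute)
  qed
  have fst0: "(\<Sum>i\<in>I. g (b i) * Poly_Mapping.lookup (fst (x i) $ l) k) = 0" for l k
  proof (rule g_sum)
    have "Poly_Mapping.lookup (fst (\<Sum>i\<in>I. tens scaleB (x i) (b i)) $ l) k = 0"
      by (simp add: sum0)
    then show "(\<Sum>i\<in>I. scaleB (Poly_Mapping.lookup (fst (x i) $ l) k) (b i)) = 0"
      by (simp add: fst_sum sum_component lookup_sum tens_def coeff_map_def lookup_map_scale')
  qed
  have snd0: "(\<Sum>i\<in>I. g (b i) * Poly_Mapping.lookup (snd (x i)) k) = 0" for k
  proof (rule g_sum)
    have "Poly_Mapping.lookup (snd (\<Sum>i\<in>I. tens scaleB (x i) (b i))) k = 0"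
      by (simp add: sum0)
    then show "(\<Sum>i\<in>I. scaleB (Poly_Mapping.lookup (snd (x i)) k) (b i)) = 0"
      by (simp add: snd_sum lookup_sum tens_def coeff_map_def lookup_map_scale')
  qed
  have times: "Poly_Mapping.lookup (Poly_Mapping.map ((*) c) f) k = c * Poly_Mapping.lookup f k"
    for c :: complex and f :: "('n, complex) laurent" and k
    by (simp add: Poly_Mapping.map.rep_eq when_def)
  have "(\<Sum>i\<in>I. scaleL (*) (g (b i)) (x i)) = 0"
    by (auto simp: prod_eq_iff vec_eq_iff fst_sum snd_sum sum_component lookup_sum scaleL_def
        coeff_map_def times fst0 snd0 intro!: poly_mapping_eqI)
  from indep[OF this] j g show False by auto
qed

end

section \<open>Modules\<close>

text \<open>
  The action is a function on the whole carrier type; only its values on the Lie algebra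
  \<open>SA_tensor scaleB\<close> are constrained or used.
\<close>

definition SA_module ::
    "(complex \<Rightarrow> 'b::comm_ring_1 \<Rightarrow> 'b) \<Rightarrow> (complex \<Rightarrow> 'v::ab_group_add \<Rightarrow> 'v) \<Rightarrow>
     (('n::finite, 'b) semidirect \<Rightarrow> 'v \<Rightarrow> 'v) \<Rightarrow> bool" where
  "SA_module scaleB scaleV act \<longleftrightarrow>
     vector_space scaleV \<and>
     (\<forall>x\<in>SA_tensor scaleB. Vector_Spaces.linear scaleV scaleV (act x)) \<and>
     (\<forall>x\<in>SA_tensor scaleB. \<forall>y\<in>SA_tensor scaleB. \<forall>v. act (x + y) v = act x v + act y v) \<and>
     (\<forall>c. \<forall>x\<in>SA_tensor scaleB. \<forall>v. act (scaleL scaleB c x) v = scaleV c (act x v)) \<and>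
     (\<forall>x\<in>SA_tensor scaleB. \<forall>y\<in>SA_tensor scaleB. \<forall>v.
        act (bracket x y) v = act x (act y v) - act y (act x v))"

definition irreducible_module ::
    "(complex \<Rightarrow> 'b::comm_ring_1 \<Rightarrow> 'b) \<Rightarrow> (complex \<Rightarrow> 'v::ab_group_add \<Rightarrow> 'v) \<Rightarrow>
     (('n::finite, 'b) semidirect \<Rightarrow> 'v \<Rightarrow> 'v) \<Rightarrow> bool" where
  "irreducible_module scaleB scaleV act \<longleftrightarrow>
     (UNIV :: 'v set) \<noteq> {0} \<and>
     (\<forall>W. module.subspace scaleV W \<and> (\<forall>x\<in>SA_tensor scaleB. \<forall>w\<in>W. act x w \<in> W) \<longrightarrow>
        W = {0} \<or> W = UNIV)"

text \<open>
  The elements of \<open>h\<close> are the \<open>D u 0 = \<Sum>i. u_i d_i\<close>.  A linear functional \<open>\<mu>\<close> on \<open>h\<close> is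
  recorded by the vector of its values \<open>\<mu>(d_i)\<close>.
\<close>

definition weight_space ::
    "(complex \<Rightarrow> 'b::comm_ring_1 \<Rightarrow> 'b) \<Rightarrow> (complex \<Rightarrow> 'v::ab_group_add \<Rightarrow> 'v) \<Rightarrow>
     (('n::finite, 'b) semidirect \<Rightarrow> 'v \<Rightarrow> 'v) \<Rightarrow> complex^'n \<Rightarrow> 'v set" where
  "weight_space scaleB scaleV act \<mu> =
     {v. \<forall>u. act (tens scaleB (D u 0) 1) v = scaleV (\<Sum>i\<in>UNIV. u $ i * \<mu> $ i) v}"

definition weight_module ::
    "(complex \<Rightarrow> 'b::comm_ring_1 \<Rightarrow> 'b) \<Rightarrow> (complex \<Rightarrow> 'v::ab_group_add \<Rightarrow> 'v) \<Rightarrow>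
     (('n::finite, 'b) semidirect \<Rightarrow> 'v \<Rightarrow> 'v) \<Rightarrow> bool" where
  "weight_module scaleB scaleV act \<longleftrightarrow>
     (\<forall>v. \<exists>!w. finite {\<mu>. w \<mu> \<noteq> 0} \<and> (\<forall>\<mu>. w \<mu> \<in> weight_space scaleB scaleV act \<mu>) \<and>
        v = (\<Sum>\<mu> | w \<mu> \<noteq> 0. w \<mu>))"

text \<open>
  Finite-dimensionality is required separately because \<open>dim\<close> is \<open>0\<close> on
  infinite-dimensional spaces.
\<close>

definition uniformly_bounded ::
    "(complex \<Rightarrow> 'b::comm_ring_1 \<Rightarrow> 'b) \<Rightarrow> (complex \<Rightarrow> 'v::ab_group_add \<Rightarrow> 'v) \<Rightarrow>
     (('n::finite, 'b) semidirect \<Rightarrow> 'v \<Rightarrow> 'v) \<Rightarrow> bool" where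
  "uniformly_bounded scaleB scaleV act \<longleftrightarrow>
     (\<exists>M>0. \<forall>\<mu>. (\<exists>S. finite S \<and> weight_space scaleB scaleV act \<mu> \<subseteq> module.span scaleV S) \<and>
        vector_space.dim scaleV (weight_space scaleB scaleV act \<mu>) \<le> M)"

end

theory Submission
  imports Defs "HOL-Library.Function_Algebras"
    "HOL-Computational_Algebra.Fundamental_Theorem_Algebra"
begin

text \<open>
  Let \<open>m\<close> be the kernel of \<open>\<psi>\<close>. Since \<open>B\<close> is the sum of
  \<open>m\<close> and the scalars, the claim says that \<open>D(u, r) c\<close> acts as zero for all
  \<open>c \<in> m\<close>, \<open>r \<noteq> 0\<close> and \<open>u\<close> orthogonal to \<open>r\<close>. By
  hypothesis \<open>t^r c\<close> acts as zero for such \<open>c\<close> and \<open>r\<close>, so that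
  \<open>D(u, r) c\<close> commutes with the whole of \<open>A_N \<otimes> B\<close>.

  A recurrent tool is that the generalised eigenspaces of an operator \<open>f\<close> are submodules, hence
  zero or everything, as soon as all commutators of \<open>f\<close> with the Lie algebra commute with
  \<open>f\<close> (\<open>locally_nilpotent_dichotomy\<close>).

  \<^emph>\<open>The monomials act injectively\<close> (\<open>t_injective\<close>). By the dichotomy,
  \<open>t^r\<close> is injective or locally nilpotent. In the second case \<open>t^r t^-r\<close> preserves the
  weight spaces, whose dimension is at most \<open>M\<close>, so that its \<open>M\<close>-th power vanishes.
  Taking commutators of this relation with the \<open>D(u, s)\<close> replaces its factors one by one by others.
  It follows that \<open>t^p\<close> has vanishing \<open>3M\<close>-th power for every
  \<open>p \<noteq> 0\<close>, and then that \<open>t^q_1 \<dots> t^q_3M = 0\<close> whenever no nonempty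
  subfamily of the exponents has sum zero. The products of \<open>t^q\<close>, \<open>q \<noteq> 0\<close>, with
  exponent sum zero form a commuting family of nilpotent operators on each weight space, so some nonzero weight
  vector is annihilated by all of them, and hence by all products of length \<open>3M\<close>. Consequently some
  nonzero vector is annihilated by all \<open>t^q\<close> with \<open>q \<noteq> 0\<close>. Such vectors form a
  submodule, so all these \<open>t^q\<close> act as zero, contrary to the hypothesis.

  \<^emph>\<open>Finite dimension.\<close> All weights lie in one coset of the lattice of exponents. Therefore,
  by injectivity, a linear operator that commutes with all monomials and preserves one nonzero weight space is
  determined by its values there, so these operators form a finite-dimensional space
  (\<open>commutant_finite_dimensional\<close>). It contains all \<open>t^-r D(u, r) c\<close> with
  \<open>c \<in> m\<close>.

  \<^emph>\<open>Reduction to the socle\<close> (\<open>socle_exists\<close>). Suppose that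
  \<open>D(w, s) c_0\<close> acts nontrivially for some \<open>c_0 \<in> m\<close>, \<open>s \<noteq> 0\<close>.
  The operators \<open>ad (D(u, 0) b)\<close>, \<open>b \<in> m\<close>, commute with each other and map
  \<open>t^-s D(w, s) c\<close> to \<open>(u, s) t^-s D(w, s) bc\<close>. A joint eigenvector gives
  \<open>c \<in> m\<close> acting nontrivially such that every \<open>b \<in> m\<close> multiplies
  \<open>c\<close> by a scalar \<open>\<beta>\<close>, modulo coefficients acting trivially, that is,
  coefficients \<open>d\<close> such that all \<open>D(y, r) d\<close> with \<open>r \<noteq> 0\<close> vanish.
  It suffices for this that one \<open>D(y, r) d\<close> with \<open>y \<noteq> 0\<close> and
  \<open>r \<noteq> 0\<close> vanishes (\<open>L_zero_single\<close>), so if \<open>\<beta> \<noteq> 0\<close>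
  then \<open>ad (D(u, 0) b)\<close> has the eigenvalue \<open>(u, r) \<beta>\<close> for every
  \<open>r \<noteq> 0\<close>, which contradicts finite dimension. So \<open>m c\<close> acts trivially.

  \<^emph>\<open>The contradiction\<close> (\<open>L_kernel_zero\<close>). Now \<open>z = D(v, 0) c\<close>
  commutes with its own commutators \<open>[D(w, r), z] = -(v, r) D(w, r) c\<close>. By the dichotomy
  \<open>z - a\<close> is nilpotent for some scalar \<open>a\<close>, and in characteristic zero so is its
  derivative \<open>D(w, r) c\<close>. The operators \<open>t^-r D(w, r) c\<close> are nilpotent of degree zero
  and commute with each other; therefore they, and with them all \<open>D(w, r) c\<close>, annihilate a common
  nonzero weight vector. The vectors annihilated by all \<open>D(w, r) c\<close> with
  \<open>r \<noteq> 0\<close> form a submodule, so all \<open>D(w, r) c\<close> vanish, contrary to the choice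
  of \<open>c\<close>.
\<close>

section \<open>Linear algebra in finite-dimensional subspaces\<close>

context vector_space
begin

lemma nontrivial_relation:
  assumes "finite t" "card t \<le> n" and x: "\<And>i. i \<le> n \<Longrightarrow> x i \<in> span t"
  shows "\<exists>c. (\<exists>i\<le>n. c i \<noteq> 0) \<and> (\<Sum>i\<le>n. scale (c i) (x i)) = 0"
proof (cases "inj_on x {..n}")
  case True
  have "dependent (x ` {..n})"
  proof (rule ccontr)
    assume "independent (x ` {..n})"
    then have "card (x ` {..n}) \<le> card t"
      using independent_span_bound[OF \<open>finite t\<close>] x by blast
    then show False using \<open>card t \<le> n\<close> card_image[OF True] by simp
  qed
  then obtain u where u: "\<exists>v\<in>x ` {..n}. u v \<noteq> 0" "(\<Sum>v\<in>x ` {..n}. scale (u v) v) = 0"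
    using dependent_finite[of "x ` {..n}"] by auto
  show ?thesis
    by (rule exI[of _ "u \<circ> x"]) (use u in \<open>auto simp: sum.reindex[OF True]\<close>)
next
  case False
  then obtain i j where ij: "i \<le> n" "j \<le> n" "i \<noteq> j" "x i = x j" by (auto simp: inj_on_def)
  define c where "c k = (if k = i then 1 else if k = j then -1 else 0 :: 'a)" for k
  have "(\<Sum>k\<le>n. scale (c k) (x k)) = (\<Sum>k\<in>{i, j}. scale (c k) (x k))"
    by (rule sum.mono_neutral_right) (use ij in \<open>auto simp: c_def\<close>)
  also have "\<dots> = 0" using ij by (simp add: c_def)
  finally show ?thesis using ij(1) by (intro exI[of _ c]) (auto simp: c_def)
qed

text \<open>A locally nilpotent operator on a space of dimension at most \<open>M\<close> has vanishing \<open>M\<close>-th power.\<close>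

lemma nilpotent_on_bound:
  assumes f: "Vector_Spaces.linear scale scale f" and t: "finite t" "card t \<le> M" "S \<subseteq> span t"
    and inv: "\<And>x. x \<in> S \<Longrightarrow> f x \<in> S" and nil: "\<And>x. x \<in> S \<Longrightarrow> \<exists>k. (f ^^ k) x = 0"
    and x: "x \<in> S"
  shows "(f ^^ M) x = 0"
proof -
  interpret f: Vector_Spaces.linear scale scale f by fact
  have hom: "module_hom scale scale (f ^^ i)" for i
    by (induction i) (auto simp: module_hom_iff module_axioms f.add f.scale)
  have inS: "(f ^^ i) x \<in> S" for i by (induction i) (auto simp: x inv)
  obtain c where c: "\<exists>i\<le>M. c i \<noteq> 0" "(\<Sum>i\<le>M. scale (c i) ((f ^^ i) x)) = 0"
    using nontrivial_relation[OF t(1,2), of "\<lambda>i. (f ^^ i) x"] inS t(3) by blast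
  define j where "j = (LEAST i. c i \<noteq> 0)"
  have j: "j \<le> M" "c j \<noteq> 0" "\<And>i. i < j \<Longrightarrow> c i = 0"
    using c(1) LeastI_ex[of "\<lambda>i. c i \<noteq> 0"] Least_le[of "\<lambda>i. c i \<noteq> 0"]
    unfolding j_def by (force dest: not_less_Least)+
  \<comment> \<open>Otherwise applying the last nonvanishing power of \<open>f\<close> isolates the term of \<open>c j\<close>.\<close>
  have "(f ^^ j) x = 0"
  proof (rule ccontr)
    assume nz: "(f ^^ j) x \<noteq> 0"
    define k where "k = (LEAST k. (f ^^ k) x = 0)"
    have k: "(f ^^ k) x = 0" unfolding k_def using nil[OF x] by (rule LeastI_ex)
    have zero: "(f ^^ i) x = 0" if "k \<le> i" for i
    proof -
      have "(f ^^ i) x = (f ^^ (i - k)) ((f ^^ k) x)"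
        using that by (simp flip: funpow_add comp_apply[of "f ^^ _"])
      then show ?thesis by (simp add: k module_hom.zero[OF hom])
    qed
    have "j < k" using nz zero by (meson not_le)
    have "0 = (f ^^ (k - 1 - j)) (\<Sum>i\<le>M. scale (c i) ((f ^^ i) x))"
      by (simp add: c(2) module_hom.zero[OF hom])
    also have "\<dots> = (\<Sum>i\<le>M. scale (c i) ((f ^^ (k - 1 - j + i)) x))"
      by (simp add: module_hom.sum[OF hom] module_hom.scale[OF hom] funpow_add)
    also have "\<dots> = (\<Sum>i\<in>{j}. scale (c i) ((f ^^ (k - 1 - j + i)) x))"
    proof (rule sum.mono_neutral_right)
      show "\<forall>i\<in>{..M} - {j}. scale (c i) ((f ^^ (k - 1 - j + i)) x) = 0"
      proof
        fix i assume "i \<in> {..M} - {j}"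
        then consider "i < j" | "k \<le> k - 1 - j + i" using \<open>j < k\<close> by fastforce
        then show "scale (c i) ((f ^^ (k - 1 - j + i)) x) = 0" by cases (auto simp: j(3) zero)
      qed
    qed (use j in auto)
    also have "\<dots> = scale (c j) ((f ^^ (k - 1)) x)" using \<open>j < k\<close> by simp
    finally have "(f ^^ (k - 1)) x = 0" using j(2) by simp
    then have "k \<le> k - 1" unfolding k_def by (rule Least_le)
    then show False using \<open>j < k\<close> by simp
  qed
  moreover have "(f ^^ M) x = (f ^^ (M - j)) ((f ^^ j) x)"
    using j(1) by (simp flip: funpow_add comp_apply[of "f ^^ _"])
  ultimately show ?thesis by (simp add: module_hom.zero[OF hom])
qed

lemma finitely_many_eigenvalues:
  fixes e :: "nat \<Rightarrow> 'a"
  assumes f: "Vector_Spaces.linear scale scale f" and t: "finite t" "\<And>i. x i \<in> span t"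
    and eig: "\<And>i. f (x i) = scale (e i) (x i)" and nz: "\<And>i. x i \<noteq> 0"
  shows "\<not> inj e"
proof
  assume "inj e"
  interpret f: Vector_Spaces.linear scale scale f by fact
  have indep: "\<forall>i<n. c i = 0" if "(\<Sum>i<n. scale (c i) (x i)) = 0" for n c
    using that
  proof (induction n arbitrary: c)
    case (Suc n)
    have "f (\<Sum>i<Suc n. scale (c i) (x i)) - scale (e n) (\<Sum>i<Suc n. scale (c i) (x i)) = 0"
      unfolding Suc.prems by (simp add: f.zero)
    then have "(\<Sum>i<Suc n. scale (c i * (e i - e n)) (x i)) = 0"
      by (simp add: f.sum f.add f.scale eig scale_sum_right scale_right_distrib algebra_simps
          scale_left_diff_distrib sum_subtractf)
    then have "\<forall>i<n. c i * (e i - e n) = 0" by (intro Suc.IH) simp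
    then have c: "\<forall>i<n. c i = 0" using \<open>inj e\<close> by (auto simp: inj_def)
    then have "scale (c n) (x n) = 0" using Suc.prems by simp
    then show ?case using c nz less_Suc_eq by auto
  qed simp
  obtain c where "\<exists>i\<le>card t. c i \<noteq> 0" "(\<Sum>i\<le>card t. scale (c i) (x i)) = 0"
    using nontrivial_relation[OF t(1) order_refl, of x] t(2) by blast
  then show False using indep[of c "Suc (card t)"] by (auto simp: lessThan_Suc_atMost)
qed

end

locale complex_vector_space = vector_space scale
  for scale :: "complex \<Rightarrow> 'v::ab_group_add \<Rightarrow> 'v"
begin

lemma eigenvector_exists:
  assumes f: "Vector_Spaces.linear scale scale f" and W: "subspace W" "W \<subseteq> span t" "finite t" "W \<noteq> {0}"
    and inv: "\<And>x. x \<in> W \<Longrightarrow> f x \<in> W"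
  shows "\<exists>a. \<exists>w\<in>W. w \<noteq> 0 \<and> f w = scale a w"
proof -
  interpret f: Vector_Spaces.linear scale scale f by fact
  obtain v where v: "v \<in> W" "v \<noteq> 0" using W(1,4) subspace_0 by blast
  have inW: "(f ^^ i) v \<in> W" for i by (induction i) (auto simp: v inv)
  define N where "N = card t"
  \<comment> \<open>\<open>ev p\<close> is \<open>p(f)\<close> applied to \<open>v\<close>; for a root \<open>a\<close> of \<open>p = (X - a) q\<close> with \<open>ev p = 0\<close>, either \<open>ev q\<close> is
    an eigenvector or \<open>ev q = 0\<close> and \<open>q\<close> has smaller degree.\<close>
  define ev where "ev p = (\<Sum>i\<le>N. scale (poly.coeff p i) ((f ^^ i) v))" for p
  have ev_W: "ev p \<in> W" for p
    unfolding ev_def by (intro subspace_sum[OF W(1)] subspace_scale[OF W(1)] inW)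
  have ev_root: "ev ([:-a, 1:] * q) = f (ev q) - scale a (ev q)" if dq: "degree q < N" for a q
  proof -
    have "ev (pCons 0 q) = f (ev q)"
    proof -
      obtain K where K: "N = Suc K" using dq by (cases N) auto
      have "poly.coeff q (Suc K) = 0" using dq K by (simp add: coeff_eq_0)
      moreover have "ev (pCons 0 q) = (\<Sum>i\<le>K. scale (poly.coeff q i) (f ((f ^^ i) v)))"
        unfolding ev_def K by (subst sum.atMost_Suc_shift) simp
      moreover have "f (ev q) = (\<Sum>i\<le>N. scale (poly.coeff q i) (f ((f ^^ i) v)))"
        by (simp add: ev_def f.sum f.scale)
      ultimately show ?thesis by (simp add: K)
    qed
    moreover have "ev ([:-a, 1:] * q) = ev (pCons 0 q) - scale a (ev q)"
      by (simp add: ev_def scale_sum_right scale_left_diff_distrib flip: sum_subtractf)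
    ultimately show ?thesis by simp
  qed
  have root: "\<exists>a. \<exists>w\<in>W. w \<noteq> 0 \<and> f w = scale a w" if "p \<noteq> 0" "degree p \<le> N" "ev p = 0" for p
    using that
  proof (induction "degree p" arbitrary: p)
    case 0
    then obtain a where a: "p = [:a:]" by (metis degree_0_id)
    have "ev p = (\<Sum>i\<in>{0}. scale (poly.coeff p i) ((f ^^ i) v))"
      unfolding ev_def by (rule sum.mono_neutral_right) (auto simp: a coeff_pCons split: nat.splits)
    then have "scale a v = 0" using 0 a by simp
    then show ?case using v(2) 0 a by simp
  next
    case (Suc d)
    have "\<not> constant (poly p)" using Suc.hyps(2) by (simp add: constant_degree)
    then obtain a where "poly p a = 0" using fundamental_theorem_of_algebra by blast
    then obtain q where q: "p = [:-a, 1:] * q" by (auto simp: poly_eq_0_iff_dvd)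
    have "q \<noteq> 0" using q Suc.prems by auto
    then have "degree p = Suc (degree q)" unfolding q by (subst degree_mult_eq) auto
    then have dq: "degree q = d" "degree q < N" using Suc.hyps Suc.prems by auto
    show ?case
    proof (cases "ev q = 0")
      case True
      then show ?thesis using Suc.hyps(1)[of q] dq \<open>q \<noteq> 0\<close> by simp
    next
      case False
      have "f (ev q) = scale a (ev q)" using ev_root[OF dq(2), of a] Suc.prems q by simp
      then show ?thesis using False ev_W by blast
    qed
  qed
  obtain c where c: "\<exists>i\<le>N. c i \<noteq> 0" "(\<Sum>i\<le>N. scale (c i) ((f ^^ i) v)) = 0"
    using nontrivial_relation[OF W(3), of N "\<lambda>i. (f ^^ i) v"] inW W(2) N_def by blast
  define p where "p = Abs_poly (\<lambda>i. if i \<le> N then c i else 0)"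
  have co: "poly.coeff p = (\<lambda>i. if i \<le> N then c i else 0)"
    unfolding p_def by (rule coeff_Abs_poly[of N]) simp
  show ?thesis
  proof (rule root)
    show "p \<noteq> 0" using c(1) co by (metis (full_types) coeff_0)
    show "degree p \<le> N" by (rule degree_le) (simp add: co)
    show "ev p = 0" using c(2) by (simp add: ev_def co)
  qed
qed

lemma joint_eigenvector_exists:
  assumes S: "subspace S" "S \<subseteq> span t" "finite t" "S \<noteq> {0}"
    and lin: "\<And>f. f \<in> \<Phi> \<Longrightarrow> Vector_Spaces.linear scale scale f"
    and inv: "\<And>f x. f \<in> \<Phi> \<Longrightarrow> x \<in> S \<Longrightarrow> f x \<in> S"
    and comm: "\<And>f g x. f \<in> \<Phi> \<Longrightarrow> g \<in> \<Phi> \<Longrightarrow> x \<in> S \<Longrightarrow> f (g x) = g (f x)"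
  shows "\<exists>v\<in>S. v \<noteq> 0 \<and> (\<forall>f\<in>\<Phi>. \<exists>a. f v = scale a v)"
proof -
  define P where "P W \<longleftrightarrow> subspace W \<and> W \<subseteq> S \<and> W \<noteq> {0} \<and> (\<forall>f\<in>\<Phi>. \<forall>x\<in>W. f x \<in> W)" for W
  have "P S" using S inv by (auto simp: P_def)
  then obtain W where W: "P W" and min: "\<And>E. P E \<Longrightarrow> dim W \<le> dim E"
    using ex_has_least_nat[of P S dim] by auto
  \<comment> \<open>On an invariant subspace of minimal dimension every member of the family is a scalar.\<close>
  have "\<exists>a. \<forall>x\<in>W. f x = scale a x" if f: "f \<in> \<Phi>" for f
  proof -
    interpret f: Vector_Spaces.linear scale scale f using lin[OF f] .
    obtain a w where w: "w \<in> W" "w \<noteq> 0" "f w = scale a w"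
      using eigenvector_exists[OF lin[OF f], of W t] W S(2,3) f unfolding P_def
      by (meson order_trans)
    define E where "E = {x \<in> W. f x = scale a x}"
    have "P E"
      unfolding P_def
    proof (intro conjI ballI)
      have "subspace W" using W by (simp add: P_def)
      then show "subspace E" unfolding E_def subspace_def
        by (simp add: f.add f.zero f.scale scale_right_distrib scale_left_commute)
      show "E \<noteq> {0}" using w by (auto simp: E_def)
      fix g x assume g: "g \<in> \<Phi>" "x \<in> E"
      interpret g: Vector_Spaces.linear scale scale g using lin[OF g(1)] .
      have x: "x \<in> W" "f x = scale a x" using g(2) by (simp_all add: E_def)
      moreover have "x \<in> S" "g x \<in> W" using x(1) g(1) W unfolding P_def by blast+
      ultimately show "g x \<in> E" using comm[OF f g(1), of x] by (simp add: E_def g.scale)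
    next
      show "E \<subseteq> S" using W unfolding E_def P_def by blast
    qed
    have "W \<subseteq> E"
    proof
      fix x assume "x \<in> W"
      obtain B where B: "B \<subseteq> E" "independent B" "E \<subseteq> span B" "card B = dim E"
        using basis_exists by blast
      obtain C where C: "C \<subseteq> W" "independent C" "W \<subseteq> span C" "card C = dim W"
        using basis_exists by blast
      have fin: "finite B" "finite C"
        proof -
        have "W \<subseteq> span t" using W S(2) unfolding P_def by blast
        moreover have "B \<subseteq> W" using B(1) unfolding E_def by blast
        ultimately show "finite B" "finite C"
          using independent_span_bound[OF S(3)] B(2) C(1,2) by (meson order_trans)+
      qed
      have "span B \<subseteq> E" using \<open>P E\<close> B(1) unfolding P_def by (simp add: span_minimal)
      show "x \<in> E"
      proof (rule ccontr)
        assume "x \<notin> E"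
        then have x: "x \<notin> span B" using \<open>span B \<subseteq> E\<close> by auto
        then have "independent (insert x B)" using B(2) independent_insert by auto
        moreover have "insert x B \<subseteq> span C" using \<open>x \<in> W\<close> B(1) C(3) unfolding E_def by blast
        ultimately have "card (insert x B) \<le> card C" using independent_span_bound[OF fin(2)] by blast
        moreover have "x \<notin> B" using x span_base by blast
        ultimately show False using min[OF \<open>P E\<close>] B(4) C(4) fin by simp
      qed
    qed
    then show ?thesis by (auto simp: E_def)
  qed
  moreover have "W \<noteq> {0}" "0 \<in> W" using W subspace_0 by (simp_all add: P_def)
  then obtain v where "v \<in> W" "v \<noteq> 0" by blast
  moreover have "W \<subseteq> S" using W unfolding P_def by blast
  ultimately show ?thesis by blast
qed

end

section \<open>The ring of additive endomorphisms\<close>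

text \<open>
  Operators on a module are handled as elements of the ring of additive endomorphisms, so that
  commutator identities become ring identities.
\<close>

typedef (overloaded) 'a endo = "{f :: 'a::ab_group_add \<Rightarrow> 'a. \<forall>x y. f (x + y) = f x + f y}"
  morphisms app Endo
  by (rule exI[of _ "\<lambda>x. x"]) simp

setup_lifting type_definition_endo

instantiation endo :: (ab_group_add) "{ring, monoid_mult}"
begin

lift_definition zero_endo :: "'a endo" is "\<lambda>x. 0" by simp
lift_definition one_endo :: "'a endo" is "\<lambda>x. x" by simp
lift_definition plus_endo :: "'a endo \<Rightarrow> 'a endo \<Rightarrow> 'a endo" is "\<lambda>f g x. f x + g x"
  by (simp add: algebra_simps)
lift_definition minus_endo :: "'a endo \<Rightarrow> 'a endo \<Rightarrow> 'a endo" is "\<lambda>f g x. f x - g x"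
  by (simp add: algebra_simps)
lift_definition uminus_endo :: "'a endo \<Rightarrow> 'a endo" is "\<lambda>f x. - f x"
  by (simp add: algebra_simps)
lift_definition times_endo :: "'a endo \<Rightarrow> 'a endo \<Rightarrow> 'a endo" is "\<lambda>f g x. f (g x)"
  by simp

instance
  by standard (transfer; simp add: fun_eq_iff algebra_simps)+

end

lemma app_add_right [simp]: "app X (v + w) = app X v + app X w"
  using app[of X] by simp

lemma app_zero_right [simp]: "app X 0 = 0"
  using app_add_right[of X 0 0] by simp

lemma app_zero [simp]: "app 0 v = 0" by transfer simp
lemma app_one [simp]: "app 1 v = v" by transfer simp
lemma app_add [simp]: "app (X + Y) v = app X v + app Y v" by transfer simp
lemma app_diff [simp]: "app (X - Y) v = app X v - app Y v" by transfer simp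
lemma app_mult [simp]: "app (X * Y) v = app X (app Y v)" by transfer simp

lemma app_power: "app (X ^ k) v = (app X ^^ k) v"
  by (induction k) simp_all

lemma endo_eqI: "(\<And>v. app X v = app Y v) \<Longrightarrow> X = Y"
  by (simp add: app_inject[symmetric] fun_eq_iff)

lemma app_Endo: "(\<And>x y. f (x + y) = f x + f y) \<Longrightarrow> app (Endo f) = f"
  by (simp add: Endo_inverse)

lemma power_commute:
  fixes X :: "'a::monoid_mult"
  assumes "X * Y = Y * X"
  shows "X ^ k * Y = Y * X ^ k"
  using assms by (induction k) (simp_all add: mult.assoc, simp flip: mult.assoc)

context complex_vector_space
begin

text \<open>Multiplication by a complex number, as an endomorphism.\<close>

definition Sc :: "complex \<Rightarrow> 'v endo" where
  "Sc c = Endo (scale c)"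

lemma app_Sc [simp]: "app (Sc c) v = scale c v"
  unfolding Sc_def by (subst app_Endo) (simp_all add: scale_right_distrib)

lemma Sc_0 [simp]: "Sc 0 = 0" and Sc_1 [simp]: "Sc 1 = 1"
  and Sc_add: "Sc (c + d) = Sc c + Sc d" and Sc_mult: "Sc (c * d) = Sc c * Sc d"
  by (auto intro!: endo_eqI simp: scale_left_distrib)

lemma Sc_Sc [simp]: "Sc c * (Sc d * X) = Sc (c * d) * X"
  by (simp add: Sc_mult mult.assoc)

lemma Sc_mult_eq_0_iff [simp]: "Sc c * X = 0 \<longleftrightarrow> c = 0 \<or> X = 0"
proof
  assume "Sc c * X = 0"
  then have "scale c (app X v) = 0" for v by (metis app_Sc app_mult app_zero)
  then show "c = 0 \<or> X = 0" by (auto intro: endo_eqI)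
qed auto

text \<open>Complex linearity of an endomorphism.\<close>

definition lin :: "'v endo \<Rightarrow> bool" where
  "lin X \<longleftrightarrow> (\<forall>c. X * Sc c = Sc c * X)"

lemma lin_app: "lin X \<Longrightarrow> app X (scale c v) = scale c (app X v)"
  unfolding lin_def by (metis app_Sc app_mult)

lemma linear_app: "lin X \<Longrightarrow> Vector_Spaces.linear scale scale (app X)"
  by unfold_locales (simp_all add: lin_app)

lemma lin_commute: "lin X \<Longrightarrow> X * (Sc c * Y) = Sc c * (X * Y)"
  unfolding lin_def by (metis mult.assoc)

lemma lin_closed [intro]:
  "lin 0" "lin 1" "lin (Sc c)" "lin X \<Longrightarrow> lin Y \<Longrightarrow> lin (X + Y)" "lin X \<Longrightarrow> lin Y \<Longrightarrow> lin (X - Y)"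
  "lin X \<Longrightarrow> lin Y \<Longrightarrow> lin (X * Y)"
  unfolding lin_def
  by (auto simp: distrib_left distrib_right left_diff_distrib right_diff_distrib mult.assoc
      mult.commute simp flip: Sc_mult) (metis mult.assoc)

text \<open>The complex vector space structure of the endomorphism ring.\<close>

definition scaleE :: "complex \<Rightarrow> 'v endo \<Rightarrow> 'v endo" where
  "scaleE c X = Sc c * X"

lemma complex_vector_space_scaleE: "complex_vector_space scaleE"
  by unfold_locales (simp_all add: scaleE_def Sc_add distrib_left distrib_right)

text \<open>
  A space of operators is finite-dimensional if its members are determined by their values on a
  finite set and these values stay in a finite-dimensional space.
\<close>

lemma operators_finite_dimensional:
  assumes S: "module.subspace scaleE S" and "finite Bs" "finite t"
    and val: "\<And>Q e. Q \<in> S \<Longrightarrow> e \<in> Bs \<Longrightarrow> app Q e \<in> span t"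
    and det: "\<And>Q. Q \<in> S \<Longrightarrow> (\<And>e. e \<in> Bs \<Longrightarrow> app Q e = 0) \<Longrightarrow> Q = 0"
  shows "\<exists>t'. finite t' \<and> S \<subseteq> module.span scaleE t'"
proof -
  interpret E: complex_vector_space scaleE by (rule complex_vector_space_scaleE)
  define scaleF where "scaleF c g = (\<lambda>x::'v. scale c (g x))" for c g
  interpret F: vector_space scaleF
    by unfold_locales
      (auto simp: scaleF_def fun_eq_iff scale_right_distrib scale_left_distrib)
  define G where "G Q = (\<lambda>x. if x \<in> Bs then app Q x else 0)" for Q
  have G: "Vector_Spaces.linear scaleE scaleF G"
    by unfold_locales (auto simp: G_def scaleF_def scaleE_def fun_eq_iff)
  interpret G: Vector_Spaces.linear scaleE scaleF G by (rule G)
  \<comment> \<open>Restriction to \<open>Bs\<close> embeds \<open>S\<close> into the space of functions spanned by the \<open>\<delta> e b\<close>.\<close>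
  define \<delta> where "\<delta> e b = (\<lambda>x::'v. if x = e then b else 0 :: 'v)" for e b
  have \<delta>: "Vector_Spaces.linear scale scaleF (\<delta> e)" for e
    by unfold_locales (auto simp: \<delta>_def scaleF_def fun_eq_iff)
  define T where "T = (\<Union>e\<in>Bs. \<delta> e ` t)"
  have "finite T" using assms(2,3) by (simp add: T_def)
  obtain B where B: "B \<subseteq> S" "E.independent B" "S \<subseteq> E.span B"
    using E.maximal_independent_subset by blast
  have span_B: "E.span B \<subseteq> S" using B(1) S by (simp add: E.span_minimal)
  have inj: "inj_on G (E.span B)"
  proof (rule inj_onI)
    fix Q R assume QR: "Q \<in> E.span B" "R \<in> E.span B" "G Q = G R"
    have "Q - R \<in> S" using E.subspace_diff[OF S, of Q R] QR span_B by blast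
    moreover have "app (Q - R) e = 0" if "e \<in> Bs" for e
      using fun_cong[OF QR(3), of e] that by (simp add: G_def)
    ultimately show "Q = R" using det by fastforce
  qed
  have "F.independent (G ` B)"
    using G.independent_injective_image[OF B(2) inj] .
  moreover have "G ` B \<subseteq> F.span T"
  proof
    fix g assume "g \<in> G ` B"
    then obtain Q where Q: "Q \<in> S" "g = G Q" using B(1) by auto
    have "g = (\<Sum>e\<in>Bs. \<delta> e (app Q e))"
    proof
      fix x
      have "(\<Sum>e\<in>A. \<delta> e (app Q e)) x = (\<Sum>e\<in>A. \<delta> e (app Q e) x)" if "finite A" for A
        using that by (induction A) auto
      then show "g x = (\<Sum>e\<in>Bs. \<delta> e (app Q e)) x"
        using \<open>finite Bs\<close> by (simp add: Q G_def \<delta>_def)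
    qed
    also have "\<dots> \<in> F.span T"
    proof (rule F.span_sum)
      fix e assume e: "e \<in> Bs"
      interpret \<delta>: Vector_Spaces.linear scale scaleF "\<delta> e" by (rule \<delta>)
      have "\<delta> e (app Q e) \<in> F.span (\<delta> e ` t)" using \<delta>.span_image[of t] val[OF Q(1) e] by auto
      then show "\<delta> e (app Q e) \<in> F.span T" using F.span_mono[of "\<delta> e ` t" T] e T_def by blast
    qed
    finally show "g \<in> F.span T" .
  qed
  ultimately have "finite (G ` B)" using F.independent_span_bound[OF \<open>finite T\<close>] by blast
  then have "finite B"
    using finite_imageD inj_on_subset[OF inj E.span_superset] by blast
  then show ?thesis using B(3) by blast
qed

lemma derivation_power:
  assumes Xf: "X * f = f * X + g" and fg: "f * g = g * f" and f: "lin f"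
  shows "X * f ^ k = f ^ k * X + Sc (of_nat k) * (f ^ (k - 1) * g)"
proof (induction k)
  case (Suc k)
  have pg: "f ^ k * g = g * f ^ k" by (rule power_commute[OF fg])
  have "X * f ^ Suc k = (X * f) * f ^ k" by (simp add: mult.assoc)
  also have "\<dots> = f * (X * f ^ k) + g * f ^ k" by (simp add: Xf distrib_right mult.assoc)
  also have "\<dots> = f ^ Suc k * X + Sc (of_nat k) * (f * f ^ (k - 1) * g) + f ^ k * g"
    by (simp add: Suc.IH distrib_left mult.assoc lin_commute[OF f] pg)
  also have "Sc (of_nat k) * (f * f ^ (k - 1) * g) = Sc (of_nat k) * (f ^ k * g)"
    by (cases k) simp_all
  finally show ?case by (simp add: Sc_add distrib_right add.assoc)
qed simp

text \<open>If \<open>f\<close> is nilpotent and \<open>g = [X, f]\<close> commutes with \<open>f\<close> and \<open>X\<close>, then \<open>g\<close> is nilpotent: each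
  commutator of \<open>f^i g^j = 0\<close> with \<open>X\<close> trades one factor \<open>f\<close> for a factor \<open>g\<close>.\<close>

lemma derivation_nilpotent:
  assumes Xf: "X * f = f * X + g" and fg: "f * g = g * f" and Xg: "X * g = g * X"
    and f: "lin f" and nil: "f ^ k = 0"
  shows "g ^ k = 0"
proof -
  have "f ^ (k - j) * g ^ j = 0" if "j \<le> k" for j
    using that
  proof (induction j)
    case (Suc j)
    define i where "i = k - Suc j"
    have i: "k - j = Suc i" using Suc.prems by (simp add: i_def)
    have IH: "f ^ Suc i * g ^ j = 0" using Suc i by simp
    have "0 = X * (f ^ Suc i * g ^ j)" by (simp only: IH mult_zero_right)
    also have "\<dots> = (f ^ Suc i * X + Sc (of_nat (Suc i)) * (f ^ i * g)) * g ^ j"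
      using derivation_power[OF Xf fg f, of "Suc i"] by (simp only: mult.assoc[symmetric] diff_Suc_1)
    also have "\<dots> = f ^ Suc i * (X * g ^ j) + Sc (of_nat (Suc i)) * (f ^ i * g ^ Suc j)"
      by (simp add: distrib_right mult.assoc)
    also have "X * g ^ j = g ^ j * X" using power_commute[of g X j] Xg by simp
    also have "f ^ Suc i * (g ^ j * X) = 0" by (metis IH mult.assoc mult_zero_left)
    finally have "Sc (of_nat (Suc i)) * (f ^ i * g ^ Suc j) = 0" by simp
    then show ?case unfolding i_def[symmetric] Sc_mult_eq_0_iff by (metis of_nat_neq_0)
  qed (use nil in simp)
  from this[of k] show ?thesis by simp
qed

end

section \<open>Exponent vectors\<close>

lemma pairing_simps [simp]:
  "pairing (u + v) r = pairing u r + pairing v r" "pairing (u - v) r = pairing u r - pairing v r"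
  "pairing (c *s u) r = c * pairing u r" "pairing u (r + s) = pairing u r + pairing u s"
  "pairing u (r - s) = pairing u r - pairing u s" "pairing u (- r) = - pairing u r"
  "pairing u 0 = 0" "pairing 0 r = 0"
  by (simp_all add: pairing_def algebra_simps sum.distrib sum_subtractf sum_distrib_left sum_negf)

lemma pairing_axis [simp]: "pairing (axis i 1) r = of_int (r $ i)"
  by (simp add: pairing_def axis_def if_distrib[of "\<lambda>x. x * _"] cong: if_cong)

text \<open>Proportionality of exponent vectors; the zero vector is proportional to every vector.\<close>

definition par :: "int ^ 'n::finite \<Rightarrow> int ^ 'n \<Rightarrow> bool" where
  "par a b \<longleftrightarrow> (\<forall>i j. a $ i * b $ j = a $ j * b $ i)"

lemma parD: "par a b \<Longrightarrow> a $ i * b $ j = a $ j * b $ i"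
  by (simp add: par_def)

lemma par_commute: "par a b \<longleftrightarrow> par b a"
  by (auto simp: par_def mult.commute)

lemma par_0 [simp]: "par 0 a" "par a 0" and par_refl [simp]: "par a a"
  by (auto simp: par_def mult.commute)

lemma par_add_iff [simp]: "par r (q + r) \<longleftrightarrow> par r q" "par r (r + q) \<longleftrightarrow> par r q"
  and par_diff_iff [simp]: "par r (q - r) \<longleftrightarrow> par r q"
  by (auto simp: par_def algebra_simps)

lemma not_par_pairing:
  fixes a b :: "int ^ 'n::finite"
  assumes "\<not> par a b"
  shows "\<exists>u. pairing u a = 0 \<and> pairing u b \<noteq> 0"
proof -
  obtain i j where ij: "a $ i * b $ j \<noteq> a $ j * b $ i" using assms by (auto simp: par_def)
  define u :: "complex ^ 'n" where "u = of_int (a $ j) *s axis i 1 - of_int (a $ i) *s axis j 1"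
  have u: "pairing u r = of_int (a $ j * r $ i - a $ i * r $ j)" for r by (simp add: u_def)
  have "pairing u a = 0" "pairing u b \<noteq> 0"
    unfolding u of_int_eq_0_iff using ij by simp_all
  then show ?thesis by blast
qed

lemma exists_not_par:
  fixes F :: "(int ^ 'n::finite) set"
  assumes "CARD('n) \<ge> 2" and F: "finite F" "0 \<notin> F"
  shows "\<exists>p. \<forall>f\<in>F. \<not> par p f"
proof -
  obtain i j :: 'n where ij: "i \<noteq> j"
    using assms(1) by (metis (full_types) One_nat_def UNIV_eq_I card.empty card.insert
        finite.emptyI insert_iff empty_iff le_0_eq le_SucE not_less_eq_eq numeral_2_eq_2)
  \<comment> \<open>A nonzero vector is proportional to at most one vector of this family.\<close>
  define p :: "int \<Rightarrow> int ^ 'n" where "p k = (\<chi> l. if l = i then 1 else if l = j then k else 0)" for k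
  have "finite {k. par (p k) f}" if f: "f \<in> F" for f
  proof -
    have "k = l" if "par (p k) f" "par (p l) f" for k l
    proof (rule ccontr)
      assume "k \<noteq> l"
      have "f $ j = k * f $ i" "f $ j = l * f $ i"
        using that[THEN parD, of i j] ij by (simp_all add: p_def)
      then have fi: "f $ i = 0" using \<open>k \<noteq> l\<close> by simp
      have "f $ m = 0" for m
        using parD[OF that(1), of i m] fi by (simp add: p_def)
      then show False using f F(2) by (metis vec_eq_iff zero_index)
    qed
    then have "is_singleton {k. par (p k) f} \<or> {k. par (p k) f} = {}"
      unfolding is_singleton_def by blast
    then show ?thesis by (auto simp: is_singleton_def)
  qed
  then have "finite (\<Union>f\<in>F. {k. par (p k) f})" using F(1) by blast
  then obtain k where "k \<notin> (\<Union>f\<in>F. {k. par (p k) f})"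
    using infinite_UNIV_int by (metis ex_new_if_finite)
  then show ?thesis by auto
qed

text \<open>The sums over the nonempty sublists of a list.\<close>

fun subsums :: "'a::ab_group_add list \<Rightarrow> 'a set" where
  "subsums [] = {}"
| "subsums (q # Q) = insert q (subsums Q \<union> (+) q ` subsums Q)"

lemma finite_subsums [simp]: "finite (subsums Q)"
  by (induction Q) auto

lemma subsums_update:
  "i < length Q \<Longrightarrow> subsums (Q[i := Q ! i + s]) \<subseteq> subsums Q \<union> (+) s ` subsums Q"
proof (induction Q arbitrary: i)
  case (Cons q Q)
  show ?case
  proof (cases i)
    case 0
    then show ?thesis by (auto simp: algebra_simps image_iff)
  next
    case (Suc k)
    have IH: "subsums (Q[k := Q ! k + s]) \<subseteq> subsums Q \<union> (+) s ` subsums Q"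
      using Cons Suc by simp
    have "x \<in> subsums (q # Q) \<union> (+) s ` subsums (q # Q)"
      if "x \<in> subsums ((q # Q)[i := (q # Q) ! i + s])" for x
    proof -
      consider "x = q" | "x \<in> subsums (Q[k := Q ! k + s])" |
        y where "y \<in> subsums (Q[k := Q ! k + s])" "x = q + y"
        using \<open>x \<in> _\<close> Suc by auto
      then show ?thesis
      proof cases
        case 3
        then consider "y \<in> subsums Q" | z where "z \<in> subsums Q" "y = s + z" using IH by blast
        then show ?thesis by cases (auto simp: 3(2) image_iff algebra_simps)
      qed (use IH in auto)
    qed
    then show ?thesis by blast
  qed
qed simp

text \<open>A list is generic with respect to \<open>r\<close> if no nonempty sublist has a sum proportional to \<open>r\<close>.\<close>

definition generic :: "int ^ 'n::finite \<Rightarrow> (int ^ 'n) list \<Rightarrow> bool" where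
  "generic r Q \<longleftrightarrow> (\<forall>x\<in>subsums Q. \<not> par r x)"

lemma generic_Cons:
  assumes "generic r (q # Q)"
  shows "generic r Q" "\<not> par r q"
    and "i < length Q \<Longrightarrow> generic r (Q[i := Q ! i + (q + r)])"
    and "i < length Q \<Longrightarrow> generic r (Q[i := Q ! i + (q - r)])"
proof -
  have np: "\<not> par r x" "\<not> par r (q + x)" if "x \<in> subsums Q" for x
    using assms that by (auto simp: generic_def)
  then show "generic r Q" "\<not> par r q" using assms by (auto simp: generic_def)
  have "\<not> par r (q + r + x)" "\<not> par r (q - r + x)" if "x \<in> subsums Q" for x
    using np(2)[OF that] par_add_iff(1)[of r "q + x"] par_diff_iff[of r "q + x"]
    by (simp_all add: algebra_simps)
  then show "generic r (Q[i := Q ! i + (q + r)])" "generic r (Q[i := Q ! i + (q - r)])"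
    if "i < length Q"
    using subsums_update[OF that, of "q + r"] subsums_update[OF that, of "q - r"] np(1)
    unfolding generic_def by blast+
qed

lemma generic_replicate:
  assumes "\<not> par r p"
  shows "generic r (replicate n p)"
proof -
  have "\<exists>k>0. x = (\<chi> i. k * p $ i)" if "x \<in> subsums (replicate n p)" for x
    using that
  proof (induction n arbitrary: x)
    case (Suc n)
    then consider "x = p" | "x \<in> subsums (replicate n p)" |
      y where "y \<in> subsums (replicate n p)" "x = p + y" by auto
    then show ?case
    proof cases
      case 1
      then show ?thesis by (intro exI[of _ 1]) (simp add: vec_eq_iff)
    next
      case 3
      then obtain k where "k > 0" "y = (\<chi> i. k * p $ i)" using Suc.IH by blast
      then show ?thesis using 3
        by (intro exI[of _ "k + 1"]) (simp add: vec_eq_iff algebra_simps)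
    qed (use Suc.IH in blast)
  qed simp
  moreover have "\<not> par r (\<chi> i. k * p $ i)" if "k > 0" for k
    using assms that by (auto simp: par_def mult.left_commute)
  ultimately show ?thesis unfolding generic_def by blast
qed

section \<open>Operators of an irreducible module\<close>

text \<open>An exponent vector as a weight: the action of \<open>t^r\<close> shifts weights by \<open>cvec r\<close>.\<close>

definition cvec :: "int ^ 'n \<Rightarrow> complex ^ 'n" where
  "cvec r = (\<chi> i. of_int (r $ i))"

lemma cvec_0 [simp]: "cvec 0 = 0" and cvec_add: "cvec (r + s) = cvec r + cvec s"
  by (simp_all add: cvec_def vec_eq_iff)

text \<open>
  The situation of the theorem in terms of operators: \<open>L u r b\<close> is the action of \<open>D(u, r) b\<close>,
  meaningful only if \<open>(u, r) = 0\<close>, and \<open>T r b\<close> is the action of \<open>t^r b\<close>.  The weight spaces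
  \<open>wt \<mu>\<close> are the joint eigenspaces of the \<open>L u 0 1\<close>, and \<open>M\<close> bounds their dimensions.
\<close>

locale current_module =
  complex_vector_space scaleV + B: complex_comm_algebra scaleB
  for scaleV :: "complex \<Rightarrow> 'v::ab_group_add \<Rightarrow> 'v"
    and scaleB :: "complex \<Rightarrow> 'b::comm_ring_1 \<Rightarrow> 'b" +
  fixes L :: "complex ^ 'n::finite \<Rightarrow> int ^ 'n \<Rightarrow> 'b \<Rightarrow> 'v endo"
    and T :: "int ^ 'n \<Rightarrow> 'b \<Rightarrow> 'v endo"
    and \<psi> :: "'b \<Rightarrow> complex" and M :: nat and wt :: "complex ^ 'n \<Rightarrow> 'v set"
  assumes card_ge_2: "CARD('n) \<ge> 2"
    and L_lin [intro, simp]: "\<And>u r b. pairing u r = 0 \<Longrightarrow> lin (L u r b)"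
    and T_lin [intro, simp]: "\<And>r b. lin (T r b)"
    and L_add: "\<And>u v r b. pairing u r = 0 \<Longrightarrow> pairing v r = 0 \<Longrightarrow>
      L (u + v) r b = L u r b + L v r b"
    and L_scale: "\<And>u r a b. pairing u r = 0 \<Longrightarrow> L (a *s u) r b = Sc a * L u r b"
    and L_add_right: "\<And>u r b c. pairing u r = 0 \<Longrightarrow> L u r (b + c) = L u r b + L u r c"
    and L_scale_right: "\<And>u r a b. pairing u r = 0 \<Longrightarrow> L u r (scaleB a b) = Sc a * L u r b"
    and LL: "\<And>u r v s b c. pairing u r = 0 \<Longrightarrow> pairing v s = 0 \<Longrightarrow>
      L u r b * L v s c =
        L v s c * L u r b + L (pairing u s *s v - pairing v r *s u) (r + s) (b * c)"
    and LT: "\<And>u r s b c. pairing u r = 0 \<Longrightarrow>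
      L u r b * T s c = T s c * L u r b + Sc (pairing u s) * T (r + s) (b * c)"
    and TT: "\<And>r s b c. T r b * T s c = T s c * T r b"
    and T_char: "\<And>r b. r \<noteq> 0 \<Longrightarrow> T r b = Sc (\<psi> b) * T r 1"
    and psi: "character scaleB \<psi>"
    and wt_eq: "\<And>\<mu>. wt \<mu> =
      {v. \<forall>u. app (L u 0 1) v = scaleV (\<Sum>i\<in>UNIV. u $ i * \<mu> $ i) v}"
    and wt_bounded: "\<And>\<mu>. \<exists>t. finite t \<and> card t \<le> M \<and> wt \<mu> \<subseteq> span t"
    and wt_ex: "\<exists>\<mu>. wt \<mu> \<noteq> {0}"
    and T_nonzero: "\<exists>s. s \<noteq> 0 \<and> T s 1 \<noteq> 0"
    and irreducible: "\<And>W. subspace W \<Longrightarrow> (\<And>r b v. v \<in> W \<Longrightarrow> app (T r b) v \<in> W) \<Longrightarrow>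
      (\<And>u r b v. pairing u r = 0 \<Longrightarrow> v \<in> W \<Longrightarrow> app (L u r b) v \<in> W) \<Longrightarrow> W = {0} \<or> W = UNIV"
begin

abbreviation t :: "int ^ 'n \<Rightarrow> 'v endo" where "t r \<equiv> T r 1"

lemma L_0 [simp]: "L 0 r b = 0"
  using L_scale[of 0 r 0 b] by simp

lemma L_zero_right: "pairing u r = 0 \<Longrightarrow> L u r 0 = 0"
  using L_scale_right[of u r 0 0] by simp

lemma L_diff_right: "pairing u r = 0 \<Longrightarrow> L u r (b - c) = L u r b - L u r c"
  using L_add_right[of u r "b - c" c] by (simp add: eq_diff_eq)

lemma Lt:
  assumes "pairing u r = 0"
  shows "L u r b * t s = t s * L u r b + Sc (pairing u s * \<psi> b) * t (r + s)"
proof (cases "r + s = 0")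
  case True
  then have "pairing u s = 0" using assms pairing_simps(4)[of u r s] by simp
  then show ?thesis using LT[OF assms, of b s 1] by simp
next
  case False
  then show ?thesis using LT[OF assms, of b s 1] T_char[of "r + s" b] by simp
qed

lemma psi_1: "\<psi> 1 = 1" and psi_mult: "\<psi> (b * c) = \<psi> b * \<psi> c"
  and psi_diff: "\<psi> (b - c) = \<psi> b - \<psi> c" and psi_add: "\<psi> (b + c) = \<psi> b + \<psi> c"
  and psi_scale: "\<psi> (scaleB a b) = a * \<psi> b"
proof -
  interpret Vector_Spaces.linear scaleB "(*)" \<psi> using psi by (simp add: character_def)
  show "\<psi> (b - c) = \<psi> b - \<psi> c" "\<psi> (b + c) = \<psi> b + \<psi> c" "\<psi> (scaleB a b) = a * \<psi> b"
    by (fact diff add scale)+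
qed (use psi in \<open>simp_all add: character_def\<close>)

lemma subspace_wt: "subspace (wt \<mu>)"
  unfolding wt_eq subspace_def
  by (simp add: scale_right_distrib lin_app scale_left_commute)

lemma wt_shift:
  assumes v: "v \<in> wt \<mu>" and X: "\<And>u. L u 0 1 * X = X * L u 0 1 + Sc (pairing u q) * X" and "lin X"
  shows "app X v \<in> wt (\<mu> + cvec q)"
  unfolding wt_eq
proof safe
  fix u
  have "app (L u 0 1 * X) v = app (X * L u 0 1 + Sc (pairing u q) * X) v" by (simp only: X)
  moreover have "pairing u q = (\<Sum>i\<in>UNIV. u $ i * cvec q $ i)"
    by (simp add: pairing_def cvec_def)
  ultimately show "app (L u 0 1) (app X v) = scaleV (\<Sum>i\<in>UNIV. u $ i * (\<mu> + cvec q) $ i) (app X v)"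
    using v \<open>lin X\<close>
    by (simp add: wt_eq lin_app distrib_left sum.distrib scale_left_distrib)
qed

lemma T_wt: "v \<in> wt \<mu> \<Longrightarrow> app (T r b) v \<in> wt (\<mu> + cvec r)"
  by (rule wt_shift) (simp_all add: LT[of _ 0])

lemma L_wt:
  assumes "pairing u r = 0" "v \<in> wt \<mu>"
  shows "app (L u r b) v \<in> wt (\<mu> + cvec r)"
proof (rule wt_shift[OF assms(2)])
  fix w
  show "L w 0 1 * L u r b = L u r b * L w 0 1 + Sc (pairing w r) * L u r b"
    using LL[of w 0 u r 1 b] assms(1) by (simp add: L_scale)
qed (use assms in simp)

text \<open>By irreducibility, all weights lie in one coset of the lattice of integral weights.\<close>

lemma span_weights:
  assumes "wt \<mu> \<noteq> {0}"
  shows "span (\<Union>q. wt (\<mu> + cvec q)) = UNIV"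
proof -
  let ?U = "\<Union>q. wt (\<mu> + cvec q)"
  have inv: "app X v \<in> span ?U"
    if X: "lin X" "\<And>q v. v \<in> wt (\<mu> + cvec q) \<Longrightarrow> app X v \<in> wt (\<mu> + cvec q + cvec r)"
      and v: "v \<in> span ?U" for X r v
    using v
  proof (induction rule: span_induct_alt)
    case (step c x y)
    then obtain q where "x \<in> wt (\<mu> + cvec q)" by blast
    then have "app X x \<in> wt (\<mu> + cvec (q + r))" using X(2) by (simp add: cvec_add add.assoc)
    then have "app X x \<in> span ?U" by (blast intro: span_base)
    then show ?case using step by (simp add: lin_app[OF X(1)] span_add span_scale)
  qed (simp add: span_zero)
  have "span ?U = {0} \<or> span ?U = UNIV"
  proof (rule irreducible)
    show "app (T r b) v \<in> span ?U" if "v \<in> span ?U" for r b v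
      by (rule inv[where r = r, OF T_lin T_wt that])
    show "app (L u r b) v \<in> span ?U" if "pairing u r = 0" "v \<in> span ?U" for u r b v
      by (rule inv[where r = r, OF L_lin[OF that(1)] L_wt[OF that(1)] that(2)])
  qed simp
  moreover have "span ?U \<noteq> {0}"
  proof -
    have "0 \<in> wt \<mu>" by (rule subspace_0[OF subspace_wt])
    then obtain v where "v \<in> wt \<mu>" "v \<noteq> 0"
      using assms by (metis (full_types) empty_iff insert_iff subsetI subset_singleton_iff)
    then have "v \<in> wt (\<mu> + cvec 0)" by simp
    then have "v \<in> span ?U" by (intro span_base UN_I[of 0] UNIV_I)
    then show ?thesis using \<open>v \<noteq> 0\<close> by (metis singletonD)
  qed
  ultimately show ?thesis by blast
qed

lemma zero_on_weights:
  assumes "wt \<mu> \<noteq> {0}" "lin X" and zero: "\<And>q v. v \<in> wt (\<mu> + cvec q) \<Longrightarrow> app X v = 0"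
  shows "X = 0"
proof (rule endo_eqI)
  fix v
  have "v \<in> span (\<Union>q. wt (\<mu> + cvec q))" using span_weights[OF assms(1)] by simp
  then have "app X v = 0"
    by (induction rule: span_induct_alt) (auto simp: lin_app[OF assms(2)] zero)
  then show "app X v = app 0 v" by simp
qed

lemma lin_power [intro]: "lin f \<Longrightarrow> lin (f ^ k)"
  by (induction k) auto

text \<open>A locally nilpotent operator of degree zero is nilpotent, because the dimensions of the weight
  spaces are bounded.\<close>

lemma nilpotent_if_locally_nilpotent:
  assumes f: "lin f" and deg: "\<And>\<mu> v. v \<in> wt \<mu> \<Longrightarrow> app f v \<in> wt \<mu>"
    and nil: "\<And>v. \<exists>k. app (f ^ k) v = 0"
  shows "f ^ M = 0"
proof -
  obtain \<mu> where \<mu>: "wt \<mu> \<noteq> {0}" using wt_ex by blast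
  show ?thesis
  proof (rule zero_on_weights[OF \<mu> lin_power[OF f]])
    fix q v assume v: "v \<in> wt (\<mu> + cvec q)"
    obtain B where "finite B" "card B \<le> M" "wt (\<mu> + cvec q) \<subseteq> span B" using wt_bounded by blast
    then show "app (f ^ M) v = 0"
      using nilpotent_on_bound[OF linear_app[OF f], of B M "wt (\<mu> + cvec q)" v] deg nil v
      by (simp add: app_power)
  qed
qed

text \<open>The vectors annihilated by some power of \<open>f\<close> form a submodule if \<open>f\<close> commutes with all \<open>T r b\<close> and
  with its commutators with all \<open>L u r b\<close>.\<close>

lemma locally_nilpotent_dichotomy:
  assumes f: "lin f" and fT: "\<And>r b. T r b * f = f * T r b"
    and fL: "\<And>u r b. pairing u r = 0 \<Longrightarrow> (L u r b * f - f * L u r b) * f = f * (L u r b * f - f * L u r b)"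
    and v: "v \<noteq> 0" "app (f ^ k) v = 0"
  shows "\<exists>j. app (f ^ j) w = 0"
proof -
  let ?W = "{v. \<exists>k. app (f ^ k) v = 0}"
  have mono: "app (f ^ l) v = 0" if "app (f ^ k) v = 0" "k \<le> l" for k l v
    using that by (metis app_mult app_zero_right le_add_diff_inverse2 power_add)
  have "?W = {0} \<or> ?W = UNIV"
  proof (rule irreducible)
    show "subspace ?W"
      unfolding subspace_def
    proof (intro conjI ballI allI)
      fix x y assume "x \<in> ?W" "y \<in> ?W"
      then obtain k l where "app (f ^ k) x = 0" "app (f ^ l) y = 0" by blast
      then have "app (f ^ max k l) (x + y) = 0" by (simp add: mono[of k _ "max k l"] mono[of l _ "max k l"])
      then show "x + y \<in> ?W" by blast
    next
      fix c x assume "x \<in> ?W"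
      then show "scaleV c x \<in> ?W" by (auto simp: lin_app[OF lin_power[OF f]])
    qed simp
  next
    fix r b v assume "v \<in> ?W"
    then obtain k where "app (f ^ k) v = 0" by blast
    moreover have "f ^ k * T r b = T r b * f ^ k" by (rule power_commute) (simp add: fT)
    ultimately have "app (f ^ k) (app (T r b) v) = 0" by (simp flip: app_mult) simp
    then show "app (T r b) v \<in> ?W" by blast
  next
    fix u :: "complex ^ 'n" and r b v assume ur: "pairing u r = 0" and "v \<in> ?W"
    then obtain k where k: "app (f ^ k) v = 0" by blast
    define g where "g = L u r b * f - f * L u r b"
    have fg: "f * g = g * f" using fL[OF ur] by (simp add: g_def)
    have "L u r b * f ^ Suc k = f ^ Suc k * L u r b + Sc (of_nat (Suc k)) * (f ^ (Suc k - 1) * g)"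
      by (rule derivation_power[OF _ fg f]) (simp add: g_def)
    also have "f ^ (Suc k - 1) * g = g * f ^ k" using power_commute[OF fg] by simp
    finally have "app (L u r b * f ^ Suc k) v =
        app (f ^ Suc k * L u r b + Sc (of_nat (Suc k)) * (g * f ^ k)) v" by simp
    moreover have "app (f ^ Suc k) v = 0" using mono[OF k] by simp
    ultimately have "app (f ^ Suc k) (app (L u r b) v) = 0"
      using k by (simp del: power_Suc)
    then show "app (L u r b) v \<in> ?W" by blast
  qed
  moreover have "v \<in> ?W" using v(2) by blast
  ultimately show ?thesis using v(1) by blast
qed

section \<open>Monomials act injectively\<close>

lemma t_commute: "t r * t s = t s * t r"
  by (rule TT)

text \<open>The product of the operators \<open>t q\<close> over a list of exponents.\<close>

fun tprod :: "(int ^ 'n) list \<Rightarrow> 'v endo" where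
  "tprod [] = 1"
| "tprod (q # Q) = t q * tprod Q"

lemma T_tprod: "T r b * tprod Q = tprod Q * T r b"
proof (induction Q)
  case (Cons q Q)
  have "T r b * tprod (q # Q) = t q * (T r b * tprod Q)"
    by (simp add: TT[of r b] flip: mult.assoc)
  then show ?case by (simp add: Cons.IH mult.assoc)
qed simp

lemma tprod_commute: "tprod P * tprod Q = tprod Q * tprod P"
proof (induction P)
  case (Cons p P)
  have "tprod (p # P) * tprod Q = t p * (tprod P * tprod Q)" by (simp add: mult.assoc)
  also have "\<dots> = (t p * tprod Q) * tprod P" by (simp only: Cons.IH mult.assoc)
  also have "\<dots> = tprod Q * tprod (p # P)" by (simp only: T_tprod tprod.simps mult.assoc)
  finally show ?case .
qed simp

lemma lin_tprod [simp]: "lin (tprod Q)"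
  by (induction Q) auto

lemma tprod_wt: "v \<in> wt \<mu> \<Longrightarrow> app (tprod Q) v \<in> wt (\<mu> + cvec (sum_list Q))"
proof (induction Q)
  case (Cons q Q)
  show ?case using T_wt[OF Cons.IH[OF Cons.prems], of q 1] by (simp add: cvec_add ac_simps)
qed simp

lemma tprod_replicate: "tprod (replicate k p) = t p ^ k"
  by (induction k) simp_all

lemma mult_power_commute:
  fixes X Y :: "'v endo"
  assumes "X * Y = Y * X"
  shows "(X * Y) ^ k = X ^ k * Y ^ k"
proof (induction k)
  case (Suc k)
  have "(X * Y) ^ Suc k = X * (Y * X ^ k) * Y ^ k" by (simp add: Suc mult.assoc)
  also have "Y * X ^ k = X ^ k * Y" using power_commute[OF assms] by simp
  finally show ?case by (simp add: mult.assoc)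
qed simp

lemma t_locally_nilpotent:
  assumes "v \<noteq> 0" "app (t r) v = 0"
  shows "\<exists>k. app (t r ^ k) w = 0"
proof (rule locally_nilpotent_dichotomy[OF T_lin _ _ assms(1), of _ _ 1])
  show "(L u s b * t r - t r * L u s b) * t r = t r * (L u s b * t r - t r * L u s b)"
    if "pairing u s = 0" for u s b
    using that by (simp add: Lt lin_commute t_commute mult.assoc)
qed (use assms in \<open>simp_all add: TT\<close>)

text \<open>The commutator with \<open>D(u, s)\<close> is a derivation that shifts one exponent at a time by \<open>s\<close>.\<close>

lemma L_tprod_commutator:
  assumes u: "pairing u s = 0" and Z: "lin Z"
    and zero: "\<And>i. i < length Q \<Longrightarrow> Z * tprod (Q[i := Q ! i + s]) = 0"
  shows "Z * (L u s 1 * tprod Q) = Z * (tprod Q * L u s 1)"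
  using Z zero
proof (induction Q arbitrary: Z)
  case (Cons q Q)
  have IH: "Z * t q * (L u s 1 * tprod Q) = Z * t q * (tprod Q * L u s 1)"
  proof (rule Cons.IH)
    show "lin (Z * t q)" using Cons.prems(1) by (simp add: lin_closed)
    show "Z * t q * tprod (Q[i := Q ! i + s]) = 0" if "i < length Q" for i
      using Cons.prems(2)[of "Suc i"] that by (simp add: mult.assoc)
  qed
  have zero: "Z * (t (s + q) * tprod Q) = 0"
    using Cons.prems(2)[of 0] by (simp add: add.commute)
  have "Z * (L u s 1 * tprod (q # Q)) = Z * ((L u s 1 * t q) * tprod Q)"
    by (simp add: mult.assoc)
  also have "\<dots> = Z * t q * (L u s 1 * tprod Q) + Sc (pairing u q) * (Z * (t (s + q) * tprod Q))"
    by (simp add: Lt[OF u] psi_1 distrib_left distrib_right mult.assoc lin_commute[OF Cons.prems(1)])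
  also have "\<dots> = Z * (tprod (q # Q) * L u s 1)" by (simp add: IH[unfolded mult.assoc] zero mult.assoc)
  finally show ?case .
qed simp

text \<open>
  Taking the commutator with \<open>D(u, s)\<close> trades one factor \<open>t p\<close> for the factor \<open>t (p + s)\<close>, provided
  that the terms in which the commutator hits another factor vanish.
\<close>

lemma trade_factor:
  assumes u: "pairing u s = 0" "pairing u p \<noteq> 0"
    and W: "lin W" and W': "L u s 1 * W = W * L u s 1 + W'"
    and zero: "W * (t p ^ Suc k * tprod Q) = 0" "W' * (t p ^ Suc k * tprod Q) = 0"
    and upd: "\<And>i. i < length Q \<Longrightarrow> W * (t p ^ Suc k * tprod (Q[i := Q ! i + s])) = 0"
  shows "W * (t p ^ k * tprod ((p + s) # Q)) = 0"
proof -
  let ?X = "L u s 1"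
  define g where "g = Sc (pairing u p) * t (s + p)"
  have Xt: "?X * t p ^ Suc k = t p ^ Suc k * ?X + Sc (of_nat (Suc k)) * (t p ^ k * g)"
    using derivation_power[of ?X "t p" g "Suc k"] Lt[OF u(1), of 1 p]
    by (simp add: g_def psi_1 lin_commute t_commute mult.assoc)
  have comm: "W * t p ^ Suc k * (?X * tprod Q) = W * t p ^ Suc k * (tprod Q * ?X)"
    by (rule L_tprod_commutator[OF u(1)]) (use W upd in \<open>auto simp: mult.assoc simp del: power_Suc\<close>)
  have "0 = ?X * (W * (t p ^ Suc k * tprod Q))" by (simp only: zero mult_zero_right)
  also have "\<dots> = W * ((?X * t p ^ Suc k) * tprod Q) + W' * (t p ^ Suc k * tprod Q)"
    by (simp only: mult.assoc[symmetric] W' distrib_right)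
  also have "\<dots> = W * ((t p ^ Suc k * ?X + Sc (of_nat (Suc k)) * (t p ^ k * g)) * tprod Q)"
    by (simp only: zero(2) Xt add_0_right)
  also have "\<dots> = W * t p ^ Suc k * (?X * tprod Q) + Sc (of_nat (Suc k)) * (W * (t p ^ k * (g * tprod Q)))"
    by (simp add: distrib_left distrib_right mult.assoc lin_commute[OF W] del: power_Suc)
  also have "W * t p ^ Suc k * (?X * tprod Q) = (W * (t p ^ Suc k * tprod Q)) * ?X"
    by (simp only: mult.assoc comm[unfolded mult.assoc])
  also have "\<dots> = 0" by (simp only: zero mult_zero_left)
  finally have "W * (t p ^ k * (g * tprod Q)) = 0"
    by (simp del: of_nat_Suc)
  then have "Sc (pairing u p) * (W * (t p ^ k * (t (s + p) * tprod Q))) = 0"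
    by (simp add: g_def lin_commute[OF W] lin_commute[OF lin_power[OF T_lin]] mult.assoc)
  then show ?thesis using u(2) by (simp add: add.commute)
qed

text \<open>
  The relations between which factors are traded. Genericity of \<open>Q\<close> with respect to \<open>r\<close> survives the shifts by
  \<open>q + r\<close> and \<open>q - r\<close> that create a new factor \<open>t q\<close> from \<open>t (- r)\<close> and from \<open>t r\<close>.
\<close>

definition vanishing :: "int ^ 'n \<Rightarrow> nat \<Rightarrow> nat \<Rightarrow> nat \<Rightarrow> bool" where
  "vanishing r a b j \<longleftrightarrow>
    (\<forall>Q. length Q = j \<longrightarrow> generic r Q \<longrightarrow> t r ^ a * (t (- r) ^ b * tprod Q) = 0)"

lemma vanishing_trade_neg:
  assumes "vanishing r a (Suc b) j"
  shows "vanishing r (Suc a) b (Suc j)"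
  unfolding vanishing_def
proof (intro allI impI)
  fix Q' assume Q': "length Q' = Suc j" "generic r Q'"
  then obtain q Q where Q: "Q' = q # Q" "length Q = j" by (auto simp: length_Suc_conv)
  define s where "s = q + r"
  note gen = generic_Cons[OF Q'(2)[unfolded Q]]
  have "\<not> par s r" using gen(2) by (simp add: s_def par_commute[of _ r])
  then obtain u where u: "pairing u s = 0" "pairing u r \<noteq> 0" using not_par_pairing by blast
  have van: "t r ^ a * (t (- r) ^ Suc b * tprod P) = 0" if "length P = j" "generic r P" for P
    using assms that unfolding vanishing_def by blast
  define W' where "W' = Sc (of_nat (Suc a)) * (t r ^ a * (Sc (pairing u r) * t (s + r)))"
  have "t r ^ Suc a * (t (- r) ^ b * tprod ((- r + s) # Q)) = 0"
  proof (rule trade_factor[OF u(1)])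
    show "pairing u (- r) \<noteq> 0" using u(2) by simp
    show "lin (t r ^ Suc a)" by auto
    show "L u s 1 * t r ^ Suc a = t r ^ Suc a * L u s 1 + W'"
      using derivation_power[of "L u s 1" "t r" "Sc (pairing u r) * t (s + r)" "Suc a"]
        Lt[OF u(1), of 1 r] by (simp add: W'_def psi_1 lin_commute t_commute mult.assoc)
    have "W' = Sc (of_nat (Suc a) * pairing u r) * (t (s + r) * t r ^ a)"
      by (simp add: W'_def lin_commute[OF lin_power[OF T_lin]] power_commute[OF t_commute]
          del: of_nat_Suc)
    then show "W' * (t (- r) ^ Suc b * tprod Q) = 0"
      by (simp only: mult.assoc van[OF Q(2) gen(1)] mult_zero_right)
    show "t r ^ Suc a * (t (- r) ^ Suc b * tprod Q) = 0"
      by (simp only: power_Suc[of _ a] mult.assoc van[OF Q(2) gen(1)] mult_zero_right)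
    show "t r ^ Suc a * (t (- r) ^ Suc b * tprod (Q[i := Q ! i + s])) = 0" if "i < length Q" for i
    proof -
      have "t r ^ a * (t (- r) ^ Suc b * tprod (Q[i := Q ! i + s])) = 0"
        using van[of "Q[i := Q ! i + s]"] Q(2) gen(3)[OF that] by (simp add: s_def)
      then show ?thesis by (simp only: power_Suc[of _ a] mult.assoc mult_zero_right)
    qed
  qed
  then show "t r ^ Suc a * (t (- r) ^ b * tprod Q') = 0" by (simp add: s_def Q)
qed

lemma vanishing_trade_pos:
  assumes "vanishing r (Suc a) 0 j"
  shows "vanishing r a 0 (Suc j)"
  unfolding vanishing_def
proof (intro allI impI)
  fix Q' assume Q': "length Q' = Suc j" "generic r Q'"
  then obtain q Q where Q: "Q' = q # Q" "length Q = j" by (auto simp: length_Suc_conv)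
  define s where "s = q - r"
  note gen = generic_Cons[OF Q'(2)[unfolded Q]]
  have "\<not> par s r" using gen(2) by (simp add: s_def par_commute[of _ r])
  then obtain u where u: "pairing u s = 0" "pairing u r \<noteq> 0" using not_par_pairing by blast
  have van: "t r ^ Suc a * tprod P = 0" if "length P = j" "generic r P" for P
    using assms that unfolding vanishing_def by force
  have "1 * (t r ^ a * tprod ((r + s) # Q)) = 0"
  proof (rule trade_factor[OF u, where W' = 0])
    show "1 * (t r ^ Suc a * tprod (Q[i := Q ! i + s])) = 0" if "i < length Q" for i
      using van[of "Q[i := Q ! i + s]"] Q(2) gen(4)[OF that] by (simp add: s_def)
  qed (use van[OF Q(2) gen(1)] in auto)
  then show "t r ^ a * (t (- r) ^ 0 * tprod Q') = 0" by (simp add: s_def Q)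
qed

lemma vanishing_all_pos:
  assumes "vanishing r a 0 j"
  shows "vanishing r 0 0 (j + a)"
  using assms
proof (induction a arbitrary: j)
  case (Suc a)
  show ?case using Suc.IH[OF vanishing_trade_pos[OF Suc.prems]] by simp
qed simp

lemma vanishing_all_neg:
  assumes "vanishing r a b j"
  shows "vanishing r (a + b) 0 (j + b)"
  using assms
proof (induction b arbitrary: a j)
  case (Suc b)
  show ?case using Suc.IH[OF vanishing_trade_neg[OF Suc.prems]] by simp
qed simp

text \<open>
  From \<open>(t r) ^ M * (t (- r)) ^ M = 0\<close> the trades lead to \<open>(t r) ^ (2 * M) * tprod Q = 0\<close> for generic \<open>Q\<close>
  of length \<open>M\<close> and then to \<open>tprod Q = 0\<close> for generic \<open>Q\<close> of length \<open>3 * M\<close>, such as \<open>3 * M\<close> copies of \<open>p\<close>.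
\<close>

lemma nilpotent_not_par:
  assumes nil: "\<And>v. \<exists>k. app (t r ^ k) v = 0" and "\<not> par r p"
  shows "t p ^ (3 * M) = 0"
proof -
  have "(t r * t (- r)) ^ M = 0"
  proof (rule nilpotent_if_locally_nilpotent)
    show "lin (t r * t (- r))" by auto
    show "app (t r * t (- r)) v \<in> wt \<mu>" if "v \<in> wt \<mu>" for \<mu> v
      using tprod_wt[OF that, of "[r, - r]"] by simp
    show "\<exists>k. app ((t r * t (- r)) ^ k) v = 0" for v
    proof -
      obtain k where "app (t r ^ k) v = 0" using nil by blast
      moreover have "(t r * t (- r)) ^ k = t (- r) ^ k * t r ^ k"
        using mult_power_commute[OF t_commute, of "- r" r k] by (simp add: t_commute[of r])
      ultimately show ?thesis by (intro exI[of _ k]) simp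
    qed
  qed
  then have "vanishing r M M 0"
    unfolding vanishing_def using mult_power_commute[OF t_commute, of r "- r" M] by simp
  then have "vanishing r 0 0 (3 * M)"
    using vanishing_all_neg[of r M M 0] vanishing_all_pos[of r "M + M" M] by (simp add: numeral_3_eq_3)
  then show ?thesis
    unfolding vanishing_def using generic_replicate[OF assms(2), of "3 * M"]
    by (auto simp: tprod_replicate dest!: spec[of _ "replicate (3 * M) p"])
qed

lemma subsums_tprod:
  "x \<in> subsums Q \<Longrightarrow> \<exists>P R. P \<noteq> [] \<and> set P \<subseteq> set Q \<and> sum_list P = x \<and> tprod Q = tprod R * tprod P"
proof (induction Q arbitrary: x)
  case (Cons q Q)
  then consider "x = q" | "x \<in> subsums Q" | y where "y \<in> subsums Q" "x = q + y" by auto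
  then show ?case
  proof cases
    case 1
    then show ?thesis
      by (intro exI[of _ "[q]"] exI[of _ Q]) (simp add: T_tprod)
  next
    case 2
    then obtain P R where "P \<noteq> []" "set P \<subseteq> set Q" "sum_list P = x" "tprod Q = tprod R * tprod P"
      using Cons.IH by blast
    then show ?thesis by (intro exI[of _ P] exI[of _ "q # R"]) (auto simp: mult.assoc)
  next
    case 3
    then obtain P R where P: "P \<noteq> []" "set P \<subseteq> set Q" "sum_list P = y" "tprod Q = tprod R * tprod P"
      using Cons.IH by blast
    then have "tprod (q # Q) = tprod R * tprod (q # P)"
      by (metis T_tprod mult.assoc tprod.simps(2))
    then show ?thesis using P 3 by (intro exI[of _ "q # P"] exI[of _ R]) auto
  qed
qed simp

theorem t_injective:
  assumes "r \<noteq> 0" "app (t r) v = 0"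
  shows "v = 0"
proof (rule ccontr)
  assume "v \<noteq> 0"
  have nil_r: "\<exists>k. app (t r ^ k) w = 0" for w
    by (rule t_locally_nilpotent[OF \<open>v \<noteq> 0\<close> assms(2)])
  define K where "K = 3 * M"
  have nil: "t p ^ K = 0" if p: "p \<noteq> 0" for p
  proof (cases "par r p")
    case True
    have "0 \<notin> {r, p}" "finite {r, p}" using assms(1) p by auto
    then obtain p' where p': "\<not> par p' r" "\<not> par p' p"
      using exists_not_par[OF card_ge_2, of "{r, p}"] by blast
    have "t p' ^ K = 0"
      using nilpotent_not_par[OF nil_r] p'(1) by (simp add: K_def par_commute[of r])
    then have "\<exists>k. app (t p' ^ k) w = 0" for w by (intro exI[of _ K]) simp
    then show ?thesis unfolding K_def by (rule nilpotent_not_par[OF _ p'(2)])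
  next
    case False
    show ?thesis unfolding K_def by (rule nilpotent_not_par[OF nil_r False])
  qed
  \<comment> \<open>Given \<open>Q\<close>, choose \<open>p\<close> such that \<open>Q\<close> is generic and trade all factors of \<open>t p ^ K\<close>.\<close>
  have zero_free: "tprod Q = 0" if Q: "length Q = K" "0 \<notin> subsums Q" for Q
  proof -
    have "0 \<notin> insert r (subsums Q)" "finite (insert r (subsums Q))" using assms(1) Q(2) by auto
    then obtain p where p: "\<forall>f\<in>insert r (subsums Q). \<not> par p f"
      using exists_not_par[OF card_ge_2] by blast
    then have "p \<noteq> 0" by auto
    then have "vanishing p K 0 0" by (simp add: vanishing_def nil)
    then have "vanishing p 0 0 K" using vanishing_all_pos[of p K 0] by simp
    then show ?thesis using p Q by (simp add: vanishing_def generic_def)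
  qed
  obtain \<mu> where \<mu>: "wt \<mu> \<noteq> {0}" using wt_ex by blast
  \<comment> \<open>Products with exponent sum zero preserve weights, so they have a joint eigenvector.\<close>
  define \<Phi> where "\<Phi> = {app (tprod P) | P. P \<noteq> [] \<and> 0 \<notin> set P \<and> sum_list P = 0}"
  obtain B where B: "finite B" "wt \<mu> \<subseteq> span B" using wt_bounded by blast
  have "\<exists>w\<in>wt \<mu>. w \<noteq> 0 \<and> (\<forall>f\<in>\<Phi>. \<exists>a. f w = scaleV a w)"
  proof (rule joint_eigenvector_exists[OF subspace_wt B(2,1) \<mu>])
    show "Vector_Spaces.linear scaleV scaleV f" if f: "f \<in> \<Phi>" for f
    proof -
      obtain P where "f = app (tprod P)" using f unfolding \<Phi>_def by blast
      then show ?thesis by (simp add: linear_app)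
    qed
    show "f x \<in> wt \<mu>" if f: "f \<in> \<Phi>" and x: "x \<in> wt \<mu>" for f x
    proof -
      obtain P where "f = app (tprod P)" "sum_list P = 0" using f unfolding \<Phi>_def by blast
      then show ?thesis using tprod_wt[OF x, of P] by simp
    qed
    show "f (g x) = g (f x)" if fg: "f \<in> \<Phi>" "g \<in> \<Phi>" for f g x
    proof -
      obtain P Q where "f = app (tprod P)" "g = app (tprod Q)" using fg unfolding \<Phi>_def by blast
      then show ?thesis by (metis app_mult tprod_commute)
    qed
  qed
  then obtain w where w: "w \<noteq> 0" "\<forall>f\<in>\<Phi>. \<exists>a. f w = scaleV a w" by (elim bexE conjE)
  have block: "app (tprod P) w = 0" if P: "P \<noteq> []" "0 \<notin> set P" "sum_list P = 0" for P
  proof -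
    have "app (tprod P) \<in> \<Phi>" unfolding \<Phi>_def using P by blast
    then obtain a where a: "app (tprod P) w = scaleV a w" using w(2) by blast
    obtain p P' where P': "P = p # P'" "p \<noteq> 0" using P(1,2) by (cases P) auto
    have "tprod P ^ K = 0"
      using mult_power_commute[OF T_tprod, of p 1 P' K] nil[OF P'(2)] by (simp add: P'(1))
    moreover have "app (tprod P ^ k) w = scaleV (a ^ k) w" for k
      by (induction k) (simp_all add: a lin_app mult.commute)
    ultimately have "scaleV (a ^ K) w = 0" by (metis app_zero)
    then show ?thesis using w(1) a by simp
  qed
  have "app (tprod Q) w = 0" if "length Q = K" "0 \<notin> set Q" for Q
  proof (cases "0 \<in> subsums Q")
    case True
    then obtain P R where "P \<noteq> []" "set P \<subseteq> set Q" "sum_list P = 0" "tprod Q = tprod R * tprod P"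
      using subsums_tprod by blast
    moreover from this have "app (tprod P) w = 0" using that(2) by (intro block) auto
    ultimately show ?thesis by simp
  qed (use zero_free[OF that(1)] in simp)
  \<comment> \<open>A longest nonvanishing product applied to \<open>w\<close> is annihilated by all monomials.\<close>
  then have ex: "\<exists>k. \<forall>Q. length Q = k \<longrightarrow> 0 \<notin> set Q \<longrightarrow> app (tprod Q) w = 0" by blast
  define k where "k = (LEAST k. \<forall>Q. length Q = k \<longrightarrow> 0 \<notin> set Q \<longrightarrow> app (tprod Q) w = 0)"
  have k: "app (tprod Q) w = 0" if "length Q = k" "0 \<notin> set Q" for Q
    using LeastI_ex[OF ex] that unfolding k_def by blast
  have "k \<noteq> 0" using k[of "[]"] w(1) by auto
  then obtain l where l: "k = Suc l" by (cases k) auto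
  have "\<not> (\<forall>Q. length Q = l \<longrightarrow> 0 \<notin> set Q \<longrightarrow> app (tprod Q) w = 0)"
    using not_less_Least[of l "\<lambda>k. \<forall>Q. length Q = k \<longrightarrow> 0 \<notin> set Q \<longrightarrow> app (tprod Q) w = 0"] l
    unfolding k_def by simp
  then obtain Q where Q: "length Q = l" "0 \<notin> set Q" "app (tprod Q) w \<noteq> 0" by blast
  define U where "U = {x. \<forall>q. q \<noteq> 0 \<longrightarrow> app (t q) x = 0}"
  have "app (tprod Q) w \<in> U"
    using k[of "_ # Q"] Q l by (auto simp: U_def)
  moreover have "U = {0} \<or> U = UNIV"
  proof (rule irreducible)
    show "subspace U" unfolding U_def subspace_def by (simp add: lin_app)
    show "app (T s b) x \<in> U" if "x \<in> U" for s b x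
      using that TT[of _ 1 s b] by (simp add: U_def flip: app_mult) simp
    show "app (L u s b) x \<in> U" if us: "pairing u s = 0" and x: "x \<in> U" for u s b x
      unfolding U_def
    proof safe
      fix q :: "int ^ 'n" assume "q \<noteq> 0"
      have *: "app (Sc (pairing u q * \<psi> b) * t (s + q)) x = 0"
      proof (cases "s + q = 0")
        case True
        then have "pairing u q = 0" using us pairing_simps(4)[of u s q] by simp
        then show ?thesis by simp
      next
        case False
        then show ?thesis using x by (simp add: U_def)
      qed
      have "app (L u s b * t q) x = app (t q * L u s b + Sc (pairing u q * \<psi> b) * t (s + q)) x"
        by (simp only: Lt[OF us])
      then show "app (t q) (app (L u s b) x) = 0"
        using * x \<open>q \<noteq> 0\<close> by (simp add: U_def del: app_Sc)
    qed
  qed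
  ultimately have U: "U = UNIV" using Q(3) by blast
  obtain s where s: "s \<noteq> 0" "t s \<noteq> 0" using T_nonzero by blast
  have "t s = 0" by (rule endo_eqI) (use U s(1) in \<open>auto simp: U_def\<close>)
  then show False using s(2) by simp
qed

section \<open>Operators commuting with the monomials\<close>

text \<open>
  The commutator is \<open>(u, s) t^(r + s) bc\<close>. Its monomial acts as zero for \<open>r + s \<noteq> 0\<close> since \<open>\<psi> (bc) = 0\<close>,
  and \<open>(u, s) = - (u, r) = 0\<close> for \<open>r + s = 0\<close>.
\<close>

lemma L_T_commute:
  assumes ur: "pairing u r = 0" and b: "\<psi> b = 0"
  shows "L u r b * T s c = T s c * L u r b"
proof (cases "r + s = 0")
  case True
  then have "pairing u s = 0" using ur pairing_simps(4)[of u r s] by simp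
  then show ?thesis using LT[OF ur, of b s c] by simp
next
  case False
  then show ?thesis using LT[OF ur, of b s c] T_char[of "r + s" "b * c"] b by (simp add: psi_mult)
qed

text \<open>The linear operators that commute with all monomials and preserve one weight space.\<close>

definition commutant :: "complex ^ 'n \<Rightarrow> 'v endo set" where
  "commutant \<mu> = {Q. lin Q \<and> (\<forall>q. Q * t q = t q * Q) \<and> (\<forall>v\<in>wt \<mu>. app Q v \<in> wt \<mu>)}"

lemma subspace_commutant: "module.subspace scaleE (commutant \<mu>)"
proof -
  interpret E: complex_vector_space scaleE by (rule complex_vector_space_scaleE)
  show ?thesis
    unfolding E.subspace_def commutant_def scaleE_def
    using subspace_wt[of \<mu>]
    by (auto simp: distrib_left distrib_right mult.assoc lin_commute subspace_def)
qed

lemma commutant_eq_0: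
  assumes "wt \<mu> \<noteq> {0}" and Q: "Q \<in> commutant \<mu>" and zero: "\<And>v. v \<in> wt \<mu> \<Longrightarrow> app Q v = 0"
  shows "Q = 0"
proof (rule zero_on_weights[OF assms(1)])
  show "lin Q" using Q by (simp add: commutant_def)
  fix q v assume v: "v \<in> wt (\<mu> + cvec q)"
  show "app Q v = 0"
  proof (cases "q = 0")
    case True
    then show ?thesis using v by (intro zero) simp
  next
    case False
    have "app (t (- q)) v \<in> wt (\<mu> + cvec q + cvec (- q))" by (rule T_wt[OF v])
    also have "\<mu> + cvec q + cvec (- q) = \<mu>" by (simp add: add.assoc flip: cvec_add)
    finally have "app (Q * t (- q)) v = 0" using zero by simp
    moreover have "Q * t (- q) = t (- q) * Q" using Q by (simp add: commutant_def)
    ultimately have "app (t (- q)) (app Q v) = 0" by simp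
    then show ?thesis by (rule t_injective[rotated]) (use False in simp)
  qed
qed

lemma commutant_finite_dimensional:
  assumes "wt \<mu> \<noteq> {0}"
  shows "\<exists>t'. finite t' \<and> commutant \<mu> \<subseteq> module.span scaleE t'"
proof -
  obtain B where B: "B \<subseteq> wt \<mu>" "independent B" "wt \<mu> \<subseteq> span B" "card B = dim (wt \<mu>)"
    by (rule basis_exists)
  obtain C where C: "finite C" "wt \<mu> \<subseteq> span C" using wt_bounded by blast
  have "finite B" using independent_span_bound[OF C(1) B(2)] B(1) C(2) by auto
  show ?thesis
  proof (rule operators_finite_dimensional[OF subspace_commutant \<open>finite B\<close> C(1)])
    show "app Q e \<in> span C" if "Q \<in> commutant \<mu>" "e \<in> B" for Q e
    proof -
      have "app Q e \<in> wt \<mu>" using that B(1) by (auto simp: commutant_def)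
      then show ?thesis using C(2) by auto
    qed
    fix Q assume Q: "Q \<in> commutant \<mu>" and zero: "\<And>e. e \<in> B \<Longrightarrow> app Q e = 0"
    have "lin Q" using Q by (simp add: commutant_def)
    show "Q = 0"
    proof (rule commutant_eq_0[OF assms Q])
      fix v assume "v \<in> wt \<mu>"
      then have "v \<in> span B" using B(3) by blast
      then show "app Q v = 0"
        by (induction rule: span_induct_alt) (simp_all add: lin_app[OF \<open>lin Q\<close>] zero)
    qed
  qed
qed

lemma tL_commutant:
  assumes ur: "pairing u r = 0" and b: "\<psi> b = 0"
  shows "t (- r) * L u r b \<in> commutant \<mu>"
proof -
  have "app (t (- r)) (app (L u r b) v) \<in> wt (\<mu> + cvec r + cvec (- r))" if "v \<in> wt \<mu>" for v
    by (intro T_wt L_wt that ur)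
  moreover have "\<mu> + cvec r + cvec (- r) = \<mu>" by (simp add: add.assoc flip: cvec_add)
  moreover have "t (- r) * L u r b * t q = t q * (t (- r) * L u r b)" for q
    by (simp add: mult.assoc L_T_commute[OF ur b]) (simp add: t_commute[of "- r"] flip: mult.assoc)
  ultimately show ?thesis using ur by (simp add: commutant_def lin_closed)
qed

lemma t_cancel:
  assumes "r \<noteq> 0" "t r * X = 0"
  shows "X = 0"
proof (rule endo_eqI)
  fix v
  have "app (t r) (app X v) = 0" using arg_cong[OF assms(2), of "\<lambda>Y. app Y v"] by simp
  then show "app X v = app 0 v" using t_injective[OF assms(1)] by simp
qed

section \<open>Coefficients acting trivially\<close>

text \<open>
  The coefficients \<open>c\<close> for which \<open>D(u, r) c\<close> acts trivially do not depend on \<open>u\<close> and \<open>r\<close>, as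
  long as these are nonzero (\<open>L_zero_single\<close>). To move from \<open>p\<close> to \<open>r\<close>, put \<open>s = p - r\<close>: the commutator of
  \<open>D(v, s)\<close> and \<open>D(w, r) c\<close> has exponent \<open>p\<close>, and a further commutator with \<open>D(v, -s)\<close> gives
  \<open>(v, r)^2 D(w, r) c\<close>.
\<close>

lemma L_zero_move:
  assumes p: "\<And>x. pairing x p = 0 \<Longrightarrow> L x p c = 0" and "\<not> par p r" and w: "pairing w r = 0"
  shows "L w r c = 0"
proof -
  define s where "s = p - r"
  have "\<not> par s r" using assms(2) by (simp add: s_def par_commute[of _ r])
  then obtain v where v: "pairing v s = 0" "pairing v r \<noteq> 0" using not_par_pairing by blast
  define x where "x = pairing v r *s w - pairing w s *s v"
  have ps: "p = r + s" by (simp add: s_def)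
  have xp: "pairing x p = 0" using v w by (simp add: x_def ps)
  have "L (pairing v p *s x - pairing x (- s) *s v) (- s + p) (1 * c) = 0"
    using LL[of v "- s" x p 1 c] v xp p[OF xp] by simp
  also have "pairing v p *s x - pairing x (- s) *s v = (pairing v r * pairing v r) *s w"
    using v w by (simp add: x_def ps vec_eq_iff algebra_simps)
  also have "- s + p = r" by (simp add: s_def)
  finally show ?thesis using w v(2) by (simp add: L_scale)
qed

lemma L_zero_all:
  assumes p: "\<And>x. pairing x p = 0 \<Longrightarrow> L x p c = 0" and "p \<noteq> 0" "r \<noteq> 0" and w: "pairing w r = 0"
  shows "L w r c = 0"
proof (cases "par p r")
  case True
  have "0 \<notin> {p, r}" "finite {p, r}" using assms(2,3) by auto
  then obtain q where q: "\<not> par q p" "\<not> par q r"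
    using exists_not_par[OF card_ge_2, of "{p, r}"] by blast
  have "L x q c = 0" if "pairing x q = 0" for x
    by (rule L_zero_move[OF p _ that]) (use q(1) in \<open>simp_all add: par_commute[of p]\<close>)
  then show ?thesis by (rule L_zero_move[OF _ q(2) w])
next
  case False
  show ?thesis by (rule L_zero_move[OF p False w])
qed

lemma par_pairing:
  assumes "par s q" "s \<noteq> 0" "pairing w s = 0"
  shows "pairing w q = 0"
proof -
  obtain k where k: "s $ k \<noteq> 0" using assms(2) by (auto simp: vec_eq_iff)
  have "of_int (s $ k) * (w $ l * of_int (q $ l)) = of_int (q $ k) * (w $ l * of_int (s $ l))" for l
  proof -
    have "complex_of_int (s $ k) * of_int (q $ l) = of_int (s $ l) * of_int (q $ k)"
      using parD[OF assms(1), of k l] by (metis of_int_mult)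
    then show ?thesis by (simp add: algebra_simps)
  qed
  then have "of_int (s $ k) * pairing w q = of_int (q $ k) * pairing w s"
    by (simp only: pairing_def sum_distrib_left)
  then show ?thesis using k assms(3) by simp
qed

lemma L_zero_single:
  assumes zero: "L w s c = 0" and w: "w \<noteq> 0" "pairing w s = 0" and "s \<noteq> 0"
    and y: "r \<noteq> 0" "pairing y r = 0"
  shows "L y r c = 0"
proof -
  obtain i where i: "w $ i \<noteq> 0" using w(1) by (auto simp: vec_eq_iff)
  define q :: "int ^ 'n" where "q = axis i 1"
  have "pairing w q = w $ i"
    by (simp add: pairing_def q_def axis_def if_distrib[of "\<lambda>x. _ * of_int x"] cong: if_cong)
  then have wq: "pairing w q \<noteq> 0" using i by simp
  have nps: "\<not> par s q" using par_pairing[OF _ assms(4) w(2)] wq by blast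
  then have "\<not> par q s" by (simp add: par_commute)
  then obtain v where v: "pairing v q = 0" "pairing v s \<noteq> 0" using not_par_pairing by blast
  \<comment> \<open>Commutators with \<open>D(v, q)\<close>: as \<open>v\<close> varies over the orthogonal complement of \<open>q\<close>, the resulting
    vectors fill that of \<open>q + s\<close>.\<close>
  have move: "L (pairing v s *s w - pairing w q *s v) (q + s) c = 0" if "pairing v q = 0" for v
    using LL[of v q w s 1 c] zero w(2) that by simp
  define x where "x = pairing v s *s w - pairing w q *s v"
  have x: "pairing x s \<noteq> 0" "pairing x (q + s) = 0" "L x (q + s) c = 0"
    using v wq w(2) move[OF v(1)] by (simp_all add: x_def)
  have "L y (q + s) c = 0" if y: "pairing y (q + s) = 0" for y
  proof -
    define a where "a = pairing y s / pairing x s"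
    define z where "z = y - a *s x"
    have zs: "pairing z s = 0" using x(1) by (simp add: z_def a_def)
    have zqs: "pairing z (q + s) = 0" by (simp only: z_def pairing_simps(2,3) x(2) y) simp
    have "pairing z q = 0" using zs zqs by simp
    from move[OF this] have "L ((- pairing w q) *s z) (q + s) c = 0"
      by (simp add: zs)
    then have "L z (q + s) c = 0" using wq L_scale[OF zqs, of "- pairing w q" c] by simp
    moreover have "y = a *s x + z" by (simp add: z_def)
    moreover have "pairing (a *s x) (q + s) = 0" using x(2) by (simp only: pairing_simps(3)) simp
    ultimately show ?thesis using L_add[OF _ zqs, of "a *s x" c] L_scale[OF x(2), of a c] x(3) by simp
  qed
  moreover have "q + s \<noteq> 0"
  proof
    assume "q + s = 0"
    then have "par s (q + s)" by simp
    then show False using nps by (simp only: par_add_iff)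
  qed
  ultimately show ?thesis using L_zero_all y by blast
qed

lemma scaleE_ad_linear:
  assumes "lin Z"
  shows "Vector_Spaces.linear scaleE scaleE (\<lambda>X. Z * X - X * Z)"
proof -
  interpret E: complex_vector_space scaleE by (rule complex_vector_space_scaleE)
  show ?thesis
    by unfold_locales
      (simp_all add: scaleE_def lin_commute[OF assms] algebra_simps)
qed

lemma ad_L_zero:
  assumes b: "\<psi> b = 0" and w: "pairing w s = 0"
  shows "L u 0 b * (t (- s) * L w s c) - (t (- s) * L w s c) * L u 0 b =
    Sc (pairing u s) * (t (- s) * L w s (b * c))"
proof -
  have "L u 0 b * (t (- s) * L w s c) = t (- s) * (L u 0 b * L w s c)"
    using L_T_commute[of u 0 b "- s" 1] b by (simp flip: mult.assoc)
  also have "L u 0 b * L w s c = L w s c * L u 0 b + Sc (pairing u s) * L w s (b * c)"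
    using LL[of u 0 w s b c] w by (simp add: L_scale)
  finally show ?thesis by (simp add: distrib_left mult.assoc lin_commute)
qed

text \<open>
  If some \<open>D(w, s) c\<close> with \<open>\<psi> c = 0\<close> acts nontrivially, then \<open>c\<close> can be chosen such that its
  products with the kernel of \<open>\<psi>\<close> act trivially.  It is obtained from a joint eigenvector of
  the commuting operators \<open>ad (D(u, 0) b)\<close>; their eigenvalues vanish because a nonzero
  one would give infinitely many eigenvalues on a finite-dimensional space.
\<close>

lemma socle_exists:
  assumes c0: "\<psi> c0 = 0" "pairing w s = 0" "s \<noteq> 0" "L w s c0 \<noteq> 0"
  obtains c where "\<psi> c = 0"
    and "\<And>r. r \<noteq> 0 \<Longrightarrow> \<exists>y. pairing y r = 0 \<and> L y r c \<noteq> 0"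
    and "\<And>b r y. \<psi> b = 0 \<Longrightarrow> r \<noteq> 0 \<Longrightarrow> pairing y r = 0 \<Longrightarrow> L y r (b * c) = 0"
proof -
  interpret E: complex_vector_space scaleE by (rule complex_vector_space_scaleE)
  obtain \<mu> where \<mu>: "wt \<mu> \<noteq> {0}" using wt_ex by blast
  obtain t' where t': "finite t'" "commutant \<mu> \<subseteq> E.span t'"
    using commutant_finite_dimensional[OF \<mu>] by blast
  have "w \<noteq> 0" using c0(4) by auto
  obtain i where i: "s $ i \<noteq> 0" using c0(3) by (auto simp: vec_eq_iff)
  define u :: "complex ^ 'n" where "u = axis i 1"
  have us: "pairing u s \<noteq> 0" using i by (simp add: u_def)
  define Q where "Q c = t (- s) * L w s c" for c
  define F where "F = {Q c | c. \<psi> c = 0}"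
  define ad where "ad b = (\<lambda>X. L u 0 b * X - X * L u 0 b)" for b
  have ad_Q: "ad b (Q c) = Sc (pairing u s) * Q (b * c)" if "\<psi> b = 0" for b c
    unfolding ad_def Q_def by (rule ad_L_zero[OF that c0(2)])
  have ad_Sc: "ad b (Sc a * X) = Sc a * ad b X" for a b X
    by (simp add: ad_def lin_commute right_diff_distrib mult.assoc)
  have "\<exists>X\<in>F. X \<noteq> 0 \<and> (\<forall>f\<in>{ad b | b. \<psi> b = 0}. \<exists>a. f X = scaleE a X)"
  proof (rule E.joint_eigenvector_exists[OF _ _ t'(1)])
    show "E.subspace F"
      unfolding E.subspace_def
    proof (intro conjI ballI allI)
      show "0 \<in> F" unfolding F_def
        using L_zero_right[OF c0(2)] psi_diff[of 0 0] by (auto simp: Q_def intro!: exI[of _ 0])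
    next
      fix X Y assume "X \<in> F" "Y \<in> F"
      then obtain c d where "X = Q c" "Y = Q d" "\<psi> c = 0" "\<psi> d = 0" unfolding F_def by blast
      then have "X + Y = Q (c + d)" "\<psi> (c + d) = 0"
        by (simp_all add: Q_def L_add_right[OF c0(2)] distrib_left psi_add)
      then show "X + Y \<in> F" unfolding F_def by blast
    next
      fix a X assume "X \<in> F"
      then obtain c where "X = Q c" "\<psi> c = 0" unfolding F_def by blast
      then have "scaleE a X = Q (scaleB a c)" "\<psi> (scaleB a c) = 0"
        by (simp_all add: Q_def scaleE_def L_scale_right[OF c0(2)] lin_commute psi_scale)
      then show "scaleE a X \<in> F" unfolding F_def by blast
    qed
    have "Q c \<in> commutant \<mu>" if "\<psi> c = 0" for c
      unfolding Q_def by (rule tL_commutant[OF c0(2) that])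
    then show "F \<subseteq> E.span t'" using t'(2) unfolding F_def by blast
    have "Q c0 \<noteq> 0" unfolding Q_def using t_cancel[of "- s"] c0(3,4) by auto
    moreover have "Q c0 \<in> F" using c0(1) unfolding F_def by blast
    ultimately show "F \<noteq> {0}" by blast
  next
    fix f assume "f \<in> {ad b | b. \<psi> b = 0}"
    then obtain b where b: "f = ad b" "\<psi> b = 0" by blast
    show "Vector_Spaces.linear scaleE scaleE f"
      unfolding b(1) ad_def by (rule scaleE_ad_linear) simp
    fix X assume "X \<in> F"
    then obtain c where c: "X = Q c" "\<psi> c = 0" unfolding F_def by blast
    have "f X = Sc (pairing u s) * Q (b * c)" by (simp only: b(1) c(1) ad_Q[OF b(2)])
    also have "\<dots> = Q (scaleB (pairing u s) (b * c))"
      by (simp add: Q_def L_scale_right[OF c0(2)] lin_commute)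
    finally have "f X = Q (scaleB (pairing u s) (b * c))" .
    moreover have "\<psi> (scaleB (pairing u s) (b * c)) = 0" using b by (simp add: psi_scale psi_mult)
    ultimately show "f X \<in> F" unfolding F_def by blast
  next
    fix f g X assume "f \<in> {ad b | b. \<psi> b = 0}" "g \<in> {ad b | b. \<psi> b = 0}" "X \<in> F"
    then obtain b d c where "f = ad b" "\<psi> b = 0" "g = ad d" "\<psi> d = 0" "X = Q c"
      unfolding F_def by blast
    then show "f (g X) = g (f X)" by (simp add: ad_Q ad_Sc mult.left_commute)
  qed
  then obtain X where X: "X \<in> F" "X \<noteq> 0" "\<forall>f\<in>{ad b | b. \<psi> b = 0}. \<exists>a. f X = scaleE a X"
    by (elim bexE conjE)
  obtain c where c: "X = Q c" "\<psi> c = 0" using X(1) unfolding F_def by blast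
  have nonzero: "\<exists>y. pairing y r = 0 \<and> L y r c \<noteq> 0" if "r \<noteq> 0" for r
  proof (rule ccontr)
    assume "\<nexists>y. pairing y r = 0 \<and> L y r c \<noteq> 0"
    then have "L w s c = 0" using L_zero_all[OF _ that c0(3,2)] by blast
    then show False using X(2) c(1) by (simp add: Q_def)
  qed
  have eig: "\<exists>\<beta>. \<forall>r y. r \<noteq> 0 \<longrightarrow> pairing y r = 0 \<longrightarrow> L y r (b * c) = Sc \<beta> * L y r c"
    if b: "\<psi> b = 0" for b
  proof -
    obtain a where "ad b X = scaleE a X" using X(3) b by blast
    then have "Sc (pairing u s) * Q (b * c) = Sc a * Q c"
      using ad_Q[OF b] c(1) by (simp add: scaleE_def)
    then have "Sc (1 / pairing u s) * (Sc (pairing u s) * Q (b * c)) =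
        Sc (1 / pairing u s) * (Sc a * Q c)" by simp
    then have Qb: "Q (b * c) = Sc (a / pairing u s) * Q c" using us by simp
    define \<beta> where "\<beta> = a / pairing u s"
    have "t (- s) * L w s (b * c - scaleB \<beta> c) = 0"
      using Qb by (simp add: Q_def L_diff_right[OF c0(2)] L_scale_right[OF c0(2)] right_diff_distrib
          lin_commute \<beta>_def)
    then have "L w s (b * c - scaleB \<beta> c) = 0" using t_cancel[of "- s"] c0(3) by simp
    then have "L y r (b * c - scaleB \<beta> c) = 0" if "r \<noteq> 0" "pairing y r = 0" for y r
      using L_zero_single[OF _ \<open>w \<noteq> 0\<close> c0(2,3) that] by blast
    then show ?thesis
      by (intro exI[of _ \<beta>]) (simp add: L_diff_right L_scale_right)
  qed
  show thesis
  proof (rule that[OF c(2) nonzero])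
    fix b r y assume b: "\<psi> b = 0" and ry: "(r :: int ^ 'n) \<noteq> 0" "pairing y r = 0"
    obtain \<beta> where \<beta>: "\<And>r y. r \<noteq> 0 \<Longrightarrow> pairing y r = 0 \<Longrightarrow> L y r (b * c) = Sc \<beta> * L y r c"
      using eig[OF b] by blast
    have "\<beta> = 0"
    proof (rule ccontr)
      assume "\<beta> \<noteq> 0"
      define R :: "nat \<Rightarrow> int ^ 'n" where "R k = axis i (of_nat (Suc k))" for k
      have R: "R k \<noteq> 0" "pairing u (R k) = of_nat (Suc k)" for k
        by (simp_all add: R_def u_def axis_eq_0_iff)
      have "\<forall>k. \<exists>y. pairing y (R k) = 0 \<and> L y (R k) c \<noteq> 0" using nonzero[OF R(1)] by blast
      from choice[OF this] obtain Y
        where "\<forall>k. pairing (Y k) (R k) = 0 \<and> L (Y k) (R k) c \<noteq> 0" ..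
      then have Y: "pairing (Y k) (R k) = 0" "L (Y k) (R k) c \<noteq> 0" for k by simp_all
      define x where "x k = t (- R k) * L (Y k) (R k) c" for k
      have "\<not> inj (\<lambda>k. of_nat (Suc k) * \<beta>)"
      proof (rule E.finitely_many_eigenvalues[OF scaleE_ad_linear t'(1)])
        show "lin (L u 0 b)" by simp
        show "x k \<in> E.span t'" for k
          using tL_commutant[OF Y(1) c(2)] t'(2) unfolding x_def by blast
        show "x k \<noteq> 0" for k
          unfolding x_def using t_cancel[of "- R k"] Y(2) R(1) by auto
        show "L u 0 b * x k - x k * L u 0 b = scaleE (of_nat (Suc k) * \<beta>) (x k)" for k
          unfolding x_def ad_L_zero[OF b Y(1)]
          by (simp add: R \<beta>[OF R(1) Y(1)] lin_commute scaleE_def del: of_nat_Suc)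
      qed
      then show False using \<open>\<beta> \<noteq> 0\<close> by (auto simp: inj_def simp del: of_nat_Suc)
    qed
    then show "L y r (b * c) = 0" using \<beta>[OF ry] by simp
  qed
qed

section \<open>The kernel of the character acts trivially\<close>

lemma L_kernel_zero:
  assumes c0: "\<psi> c0 = 0" "pairing w0 s0 = 0" "s0 \<noteq> 0"
  shows "L w0 s0 c0 = 0"
proof (rule ccontr)
  assume "L w0 s0 c0 \<noteq> 0"
  then obtain c where c: "\<psi> c = 0" "\<And>r. r \<noteq> 0 \<Longrightarrow> \<exists>y. pairing y r = 0 \<and> L y r c \<noteq> 0"
    and soc: "\<And>b r y. \<psi> b = 0 \<Longrightarrow> r \<noteq> 0 \<Longrightarrow> pairing y r = 0 \<Longrightarrow> L y r (b * c) = 0"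
    using socle_exists[OF c0] by metis
  obtain \<mu> where \<mu>: "wt \<mu> \<noteq> {0}" using wt_ex by blast
  obtain B where B: "finite B" "wt \<mu> \<subseteq> span B" using wt_bounded by blast
  have nilpotent: "L w r c ^ M = 0" if r: "r \<noteq> 0" and w: "pairing w r = 0" for w r
  proof -
    obtain i where i: "r $ i \<noteq> 0" using r by (auto simp: vec_eq_iff)
    define v :: "complex ^ 'n" where "v = axis i 1"
    have vr: "pairing v r \<noteq> 0" using i by (simp add: v_def)
    define z where "z = L v 0 c"
    have lz: "lin z" by (simp add: z_def)
    have zwt: "app z x \<in> wt \<nu>" if "x \<in> wt \<nu>" for x \<nu>
      using L_wt[of v 0 x \<nu> c] that by (simp add: z_def)
    have "\<exists>a. \<exists>x\<in>wt \<mu>. x \<noteq> 0 \<and> app z x = scaleV a x"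
      by (rule eigenvector_exists[OF linear_app[OF lz] subspace_wt B(2,1) \<mu> zwt])
    then obtain a x where x: "x \<noteq> 0" "app z x = scaleV a x" by (elim exE bexE conjE)
    define f where "f = z - Sc a"
    have lf: "lin f" using lz by (auto simp: f_def)
    have comm: "L y s b * f - f * L y s b = Sc (- pairing v s) * L y s (b * c)"
      if y: "pairing y s = 0" for y s b
      using LL[of y s v 0 b c] y L_scale[OF y, of "- pairing v s" "b * c"] L_lin[OF y, of b]
      by (simp add: f_def z_def lin_def algebra_simps)
    have "f ^ M = 0"
    proof (rule nilpotent_if_locally_nilpotent[OF lf])
      show "app f x \<in> wt \<nu>" if "x \<in> wt \<nu>" for x \<nu>
        using zwt[OF that] that by (simp add: f_def subspace_diff[OF subspace_wt]
            subspace_scale[OF subspace_wt])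
      show "\<exists>k. app (f ^ k) y = 0" for y
      proof (rule locally_nilpotent_dichotomy[OF lf _ _ x(1)])
        show "app (f ^ 1) x = 0" using x(2) by (simp add: f_def)
        show "T r b * f = f * T r b" for r b
          using L_T_commute[of v 0 c r b] c(1) T_lin[of r b]
          by (simp add: f_def z_def lin_def right_diff_distrib left_diff_distrib)
        show "(L y s b * f - f * L y s b) * f = f * (L y s b * f - f * L y s b)"
          if y: "pairing y s = 0" for y s b
        proof (cases "s = 0")
          case False
          have "f * L y s (b * c) = L y s (b * c) * f"
            using comm[OF y, of "b * c"] soc[of "b * c" s y] False y c(1) by (simp add: psi_mult)
          then show ?thesis by (simp only: comm[OF y] lin_commute[OF lf] mult.assoc)
        qed (use y in \<open>simp add: comm\<close>)
      qed
    qed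
    \<comment> \<open>With this factor, \<open>[k D(w, r), f] = D(w, r) c\<close>.\<close>
    define k where "k = - 1 / pairing v r"
    have k: "pairing v r * k = - 1" using vr by (simp add: k_def)
    define X where "X = L (k *s w) r 1"
    have w': "pairing (k *s w) r = 0" using w by simp
    have "X * f - f * X = Sc (- pairing v r * k) * L w r c"
      unfolding X_def comm[OF w'] by (simp add: L_scale[OF w])
    then have "X * f - f * X = L w r c" by (simp add: k)
    then have "X * f = f * X + L w r c" by (simp add: algebra_simps)
    moreover have "f * L w r c = L w r c * f"
      using comm[OF w, of c] soc[OF c(1) r w] by simp
    moreover have "X * L w r c = L w r c * X"
      using LL[OF w' w, of 1 c] w by (simp add: X_def)
    ultimately show ?thesis using derivation_nilpotent[OF _ _ _ lf \<open>f ^ M = 0\<close>] by blast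
  qed
  have L_commute: "L w r c * L w' r' c = L w' r' c * L w r c"
    if "r \<noteq> 0" "pairing w r = 0" "pairing w' r' = 0" for w r w' r'
  proof (cases "r + r' = 0")
    case True
    then have "r' = - r" by (simp add: eq_neg_iff_add_eq_0 add.commute)
    then show ?thesis using LL[OF that(2,3), of c c] that by simp
  next
    case False
    have "pairing (pairing w r' *s w' - pairing w' r *s w) (r + r') = 0" using that(2,3) by simp
    then show ?thesis using LL[OF that(2,3), of c c] soc[OF c(1) False] by simp
  qed
  define \<Phi> where "\<Phi> = {app (t (- r) * L w r c) | r w. r \<noteq> 0 \<and> pairing w r = 0}"
  have "\<exists>x\<in>wt \<mu>. x \<noteq> 0 \<and> (\<forall>f\<in>\<Phi>. \<exists>a. f x = scaleV a x)"
  proof (rule joint_eigenvector_exists[OF subspace_wt B(2,1) \<mu>])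
    fix f assume "f \<in> \<Phi>"
    then obtain r w where f: "f = app (t (- r) * L w r c)" "r \<noteq> 0" "pairing w r = 0"
      unfolding \<Phi>_def by blast
    have com: "t (- r) * L w r c \<in> commutant \<mu>" by (rule tL_commutant[OF f(3) c(1)])
    then show "Vector_Spaces.linear scaleV scaleV f" "\<And>x. x \<in> wt \<mu> \<Longrightarrow> f x \<in> wt \<mu>"
      unfolding f(1) commutant_def by (blast intro: linear_app)+
    fix g x assume "g \<in> \<Phi>"
    then obtain r' w' where g: "g = app (t (- r') * L w' r' c)" "r' \<noteq> 0" "pairing w' r' = 0"
      unfolding \<Phi>_def by blast
    have "t (- r) * L w r c * (t (- r') * L w' r' c) = t (- r) * t (- r') * (L w r c * L w' r' c)"
      using L_T_commute[OF f(3) c(1), of "- r'" 1] by (metis mult.assoc)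
    also have "\<dots> = t (- r') * t (- r) * (L w' r' c * L w r c)"
      by (simp only: L_commute[OF f(2,3) g(3)] t_commute[of "- r"])
    also have "\<dots> = t (- r') * L w' r' c * (t (- r) * L w r c)"
      using L_T_commute[OF g(3) c(1), of "- r" 1] by (metis mult.assoc)
    finally show "f (g x) = g (f x)" unfolding f(1) g(1) by (metis app_mult)
  qed
  then obtain x where x: "x \<noteq> 0" "\<forall>f\<in>\<Phi>. \<exists>a. f x = scaleV a x" by (elim bexE conjE)
  \<comment> \<open>The joint eigenvector is annihilated by all \<open>D(w, r) c\<close>, since these are nilpotent.\<close>
  define U where "U = {x. \<forall>r w. r \<noteq> 0 \<longrightarrow> pairing w r = 0 \<longrightarrow> app (L w r c) x = 0}"
  have "app (L w r c) x = 0" if r: "r \<noteq> 0" and w: "pairing w r = 0" for r w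
  proof -
    let ?N = "t (- r) * L w r c"
    have "app ?N \<in> \<Phi>" unfolding \<Phi>_def using r w by blast
    then obtain a where a: "app ?N x = scaleV a x" using x(2) by blast
    have "?N ^ M = 0"
      using mult_power_commute[of "t (- r)" "L w r c" M] L_T_commute[OF w c(1), of "- r" 1]
        nilpotent[OF r w] by simp
    moreover have "app (?N ^ k) x = scaleV (a ^ k) x" for k
    proof (induction k)
      case (Suc k)
      have "lin ?N" using w by auto
      have "app (?N ^ Suc k) x = app ?N (app (?N ^ k) x)" by (simp only: power_Suc app_mult)
      then show ?case by (simp only: Suc.IH lin_app[OF \<open>lin ?N\<close>] a) (simp add: mult.commute)
    qed simp
    ultimately have "scaleV (a ^ M) x = 0" by (metis app_zero)
    then have "app (t (- r)) (app (L w r c) x) = 0" using x(1) a by simp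
    then show ?thesis using t_injective[of "- r"] r by simp
  qed
  then have "x \<in> U" unfolding U_def by blast
  moreover have "U = {0} \<or> U = UNIV"
  proof (rule irreducible)
    show "subspace U" unfolding U_def subspace_def by (simp add: lin_app)
    show "app (T q b) y \<in> U" if y: "y \<in> U" for q b y
      unfolding U_def
    proof safe
      fix r :: "int ^ 'n" and w assume rw: "r \<noteq> 0" "pairing w r = 0"
      have "app (L w r c * T q b) y = app (T q b * L w r c) y"
        by (simp only: L_T_commute[OF rw(2) c(1)])
      then show "app (L w r c) (app (T q b) y) = 0" using y rw by (simp add: U_def)
    qed
    show "app (L v s b) y \<in> U" if v: "pairing v s = 0" and y: "y \<in> U" for v s b y
      unfolding U_def
    proof safe
      fix r :: "int ^ 'n" and w assume rw: "r \<noteq> 0" "pairing w r = 0"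
      define e where "e = pairing w s *s v - pairing v r *s w"
      have e: "pairing e (r + s) = 0" using v rw by (simp add: e_def)
      have "app (L e (r + s) (c * b)) y = 0"
      proof (cases "r + s = 0")
        case True
        then have "s = - r" by (simp add: eq_neg_iff_add_eq_0 add.commute)
        then have "e = 0" using v rw by (simp add: e_def)
        then show ?thesis by simp
      next
        case False
        have "\<psi> (b - scaleB (\<psi> b) 1) = 0" by (simp add: psi_diff psi_scale psi_1)
        then have "L e (r + s) ((b - scaleB (\<psi> b) 1) * c) = 0" using soc False e by blast
        moreover have "(b - scaleB (\<psi> b) 1) * c = c * b - scaleB (\<psi> b) c"
          using B.scale_mult_left[of "\<psi> b" 1 c] by (simp add: left_diff_distrib mult.commute[of b])
        ultimately have "L e (r + s) (c * b) = Sc (\<psi> b) * L e (r + s) c"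
          by (simp add: L_diff_right[OF e] L_scale_right[OF e])
        then show ?thesis using y False e by (simp add: U_def)
      qed
      moreover have "app (L w r c * L v s b) y = app (L v s b * L w r c + L e (r + s) (c * b)) y"
        using LL[OF rw(2) v, of c b] by (simp only: e_def)
      ultimately show "app (L w r c) (app (L v s b) y) = 0" using y rw by (simp add: U_def)
    qed
  qed
  ultimately have U: "U = UNIV" using x(1) by blast
  obtain y where y: "pairing y s0 = 0" "L y s0 c \<noteq> 0" using c(2)[OF c0(3)] by blast
  have "L y s0 c = 0" by (rule endo_eqI) (use U c0(3) y(1) in \<open>auto simp: U_def\<close>)
  then show False using y(2) by simp
qed

theorem L_character:
  assumes "r \<noteq> 0" "pairing u r = 0"
  shows "L u r b = Sc (\<psi> b) * L u r 1"
proof -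
  have "L u r (b - scaleB (\<psi> b) 1) = 0"
    by (rule L_kernel_zero) (use assms in \<open>simp_all add: psi_diff psi_scale psi_1\<close>)
  then show ?thesis using assms(2) by (simp add: L_diff_right L_scale_right)
qed

end

section \<open>Modules as systems of operators\<close>

lemma D_add: "D (u + v) r = D u r + D v r"
  by (simp add: D_def vec_eq_iff single_add)

lemma map_times_single:
  "Poly_Mapping.map ((*) a) (Poly_Mapping.single r c) = Poly_Mapping.single r (a * c :: complex)"
  by (rule poly_mapping_eqI) (simp add: Poly_Mapping.map.rep_eq lookup_single when_def)

lemma map_times_0: "Poly_Mapping.map ((*) a) (0 :: _ \<Rightarrow>\<^sub>0 complex) = 0"
  by (rule poly_mapping_eqI) (simp add: Poly_Mapping.map.rep_eq)

lemma D_scale: "D (a *s u) r = scaleL (*) a (D u r)"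
  by (simp add: D_def scaleL_def coeff_map_def vec_eq_iff map_times_single map_times_0)

lemma mono_A_scale: "(0, Poly_Mapping.single r a) = scaleL (*) a (mono_A r)"
  by (simp add: mono_A_def scaleL_def coeff_map_def vec_eq_iff map_times_single map_times_0)

lemma D_mem_SA: "pairing u r = 0 \<Longrightarrow> D u r \<in> SA"
  and mono_A_mem_SA: "mono_A r \<in> SA"
proof -
  interpret A: complex_comm_algebra "(*) :: complex \<Rightarrow> complex \<Rightarrow> complex"
    by unfold_locales (simp_all add: algebra_simps)
  interpret vector_space "scaleL ((*) :: complex \<Rightarrow> complex \<Rightarrow> complex)"
    by (rule A.vector_space_scaleL)
  show "pairing u r = 0 \<Longrightarrow> D u r \<in> SA" unfolding SA_def by (blast intro: span_base)
  show "mono_A r \<in> SA" unfolding SA_def by (blast intro: span_base)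
qed

text \<open>An irreducible module over \<open>(S_N \<ltimes> A_N) \<otimes> B\<close>.\<close>

locale irreducible_SA_module = A: complex_comm_algebra scaleB
  for scaleB :: "complex \<Rightarrow> 'b::comm_ring_1 \<Rightarrow> 'b" +
  fixes scaleV :: "complex \<Rightarrow> 'v::ab_group_add \<Rightarrow> 'v"
    and act :: "('n::finite, 'b) semidirect \<Rightarrow> 'v \<Rightarrow> 'v"
  assumes is_module: "SA_module scaleB scaleV act"
    and irred: "irreducible_module scaleB scaleV act"
begin

sublocale V: complex_vector_space scaleV
  using is_module by (simp add: SA_module_def complex_vector_space_def)

interpretation C: complex_comm_algebra "(*) :: complex \<Rightarrow> complex \<Rightarrow> complex"
  by unfold_locales (simp_all add: algebra_simps)

interpretation SC: vector_space "scaleL ((*) :: complex \<Rightarrow> complex \<Rightarrow> complex)"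
  by (rule C.vector_space_scaleL)

interpretation SB: vector_space "scaleL scaleB"
  by (rule A.vector_space_scaleL)

lemma tens_mem: "x \<in> SA \<Longrightarrow> tens scaleB x b \<in> SA_tensor scaleB"
  unfolding SA_tensor_def by (blast intro: SB.span_base)

lemma subspace_SA: "SC.subspace SA" and subspace_SA_tensor: "SB.subspace (SA_tensor scaleB)"
  by (simp_all add: SA_def SA_tensor_def)

lemma zero_mem_SA: "0 \<in> SA" and scaleL_mem_SA: "x \<in> SA \<Longrightarrow> scaleL (*) a x \<in> SA"
  by (simp_all add: SC.subspace_0[OF subspace_SA] SC.subspace_scale[OF subspace_SA])

lemma act_linear: "x \<in> SA_tensor scaleB \<Longrightarrow> Vector_Spaces.linear scaleV scaleV (act x)"
  and act_add: "x \<in> SA_tensor scaleB \<Longrightarrow> y \<in> SA_tensor scaleB \<Longrightarrow> act (x + y) v = act x v + act y v"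
  and act_scale: "x \<in> SA_tensor scaleB \<Longrightarrow> act (scaleL scaleB a x) v = scaleV a (act x v)"
  and act_bracket: "x \<in> SA_tensor scaleB \<Longrightarrow> y \<in> SA_tensor scaleB \<Longrightarrow>
    act (bracket x y) v = act x (act y v) - act y (act x v)"
  using is_module by (simp_all add: SA_module_def)

text \<open>The operator by which a pure tensor acts; it is additive for \<open>x \<in> SA\<close>, and only then meaningful.\<close>

definition op :: "('n, complex) semidirect \<Rightarrow> 'b \<Rightarrow> 'v endo" where
  "op x b = Endo (act (tens scaleB x b))"

lemma app_op:
  assumes "x \<in> SA"
  shows "app (op x b) v = act (tens scaleB x b) v"
proof -
  interpret Vector_Spaces.linear scaleV scaleV "act (tens scaleB x b)"
    by (rule act_linear[OF tens_mem[OF assms]])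
  show ?thesis unfolding op_def by (subst app_Endo) (simp_all add: add)
qed

lemma lin_op: "x \<in> SA \<Longrightarrow> V.lin (op x b)"
  unfolding V.lin_def
proof (intro allI endo_eqI)
  fix c v assume x: "x \<in> SA"
  interpret Vector_Spaces.linear scaleV scaleV "act (tens scaleB x b)"
    by (rule act_linear[OF tens_mem[OF x]])
  show "app (op x b * V.Sc c) v = app (V.Sc c * op x b) v" by (simp add: app_op[OF x] scale)
qed

lemma op_add: "x \<in> SA \<Longrightarrow> y \<in> SA \<Longrightarrow> op (x + y) b = op x b + op y b"
  by (rule endo_eqI)
    (simp add: app_op SC.subspace_add[OF subspace_SA] A.tens_add_left act_add tens_mem)

lemma op_scale: "x \<in> SA \<Longrightarrow> op (scaleL (*) a x) b = V.Sc a * op x b"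
  by (rule endo_eqI)
    (simp add: app_op SC.subspace_scale[OF subspace_SA] A.tens_scale_left act_scale tens_mem)

lemma op_add_right: "x \<in> SA \<Longrightarrow> op x (b + c) = op x b + op x c"
  by (rule endo_eqI) (simp add: app_op A.tens_add_right act_add tens_mem)

lemma op_scale_right: "x \<in> SA \<Longrightarrow> op x (scaleB a b) = V.Sc a * op x b"
  by (rule endo_eqI) (simp add: app_op A.tens_scale_right act_scale tens_mem)

lemma op_bracket:
  assumes "x \<in> SA" "y \<in> SA" "bracket x y \<in> SA"
  shows "op x b * op y c = op y c * op x b + op (bracket x y) (b * c)"
proof (rule endo_eqI)
  fix v
  have "act (tens scaleB (bracket x y) (b * c)) v =
      act (tens scaleB x b) (act (tens scaleB y c) v) - act (tens scaleB y c) (act (tens scaleB x b) v)"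
    using act_bracket[OF tens_mem[OF assms(1), of b] tens_mem[OF assms(2), of c], of v]
    by (simp add: A.bracket_tens)
  then show "app (op x b * op y c) v = app (op y c * op x b + op (bracket x y) (b * c)) v"
    by (simp add: app_op assms)
qed

lemma op_0: "op 0 b = 0"
  using op_scale[OF mono_A_mem_SA, of 0 0 b] by simp

lemma irreducible_generators:
  assumes W: "V.subspace W"
    and T: "\<And>r b v. v \<in> W \<Longrightarrow> app (op (mono_A r) b) v \<in> W"
    and L: "\<And>u r b v. pairing u r = 0 \<Longrightarrow> v \<in> W \<Longrightarrow> app (op (D u r) b) v \<in> W"
  shows "W = {0} \<or> W = UNIV"
proof -
  define S where "S = {x \<in> SA. \<forall>b. \<forall>v\<in>W. app (op x b) v \<in> W}"
  have "SC.subspace S"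
    unfolding SC.subspace_def
  proof (intro conjI ballI allI)
    show "0 \<in> S" by (simp add: S_def op_0 zero_mem_SA V.subspace_0[OF W])
    show "x + y \<in> S" if "x \<in> S" "y \<in> S" for x y
      using that by (simp add: S_def op_add SC.subspace_add[OF subspace_SA] V.subspace_add[OF W])
    show "scaleL (*) a x \<in> S" if "x \<in> S" for a x
      using that by (simp add: S_def op_scale scaleL_mem_SA V.subspace_scale[OF W])
  qed
  moreover have "{D u r | u r. pairing u r = 0} \<union> range mono_A \<subseteq> S"
    unfolding S_def using T L D_mem_SA mono_A_mem_SA by auto
  ultimately have S: "SA \<subseteq> S" unfolding SA_def by (rule SC.span_minimal[rotated])
  define R where "R = {x \<in> SA_tensor scaleB. \<forall>v\<in>W. act x v \<in> W}"
  have act_0: "act 0 v = 0" for v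
    using act_scale[OF SB.subspace_0[OF subspace_SA_tensor], of 0 v] by simp
  have "SB.subspace R"
    unfolding SB.subspace_def
  proof (intro conjI ballI allI)
    show "0 \<in> R"
      by (simp add: R_def act_0 SB.subspace_0[OF subspace_SA_tensor] V.subspace_0[OF W])
    show "x + y \<in> R" if "x \<in> R" "y \<in> R" for x y
      using that
      by (simp add: R_def act_add SB.subspace_add[OF subspace_SA_tensor] V.subspace_add[OF W])
    show "scaleL scaleB a x \<in> R" if "x \<in> R" for a x
      using that
      by (simp add: R_def act_scale SB.subspace_scale[OF subspace_SA_tensor] V.subspace_scale[OF W])
  qed
  moreover have "{tens scaleB x b | x b. x \<in> SA} \<subseteq> R"
  proof
    fix y :: "('n, 'b) semidirect" assume "y \<in> {tens scaleB x b | x b. x \<in> SA}"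
    then obtain x b where x: "y = tens scaleB x b" "x \<in> SA" by blast
    then have "\<forall>v\<in>W. app (op x b) v \<in> W" using S unfolding S_def by blast
    then show "y \<in> R" using tens_mem[OF x(2), of b] by (simp add: R_def x(1) app_op[OF x(2)])
  qed
  ultimately have "SA_tensor scaleB \<subseteq> R" unfolding SA_tensor_def by (rule SB.span_minimal[rotated])
  then have "V.subspace W \<and> (\<forall>x\<in>SA_tensor scaleB. \<forall>w\<in>W. act x w \<in> W)"
    using W unfolding R_def by blast
  then show ?thesis using irred unfolding irreducible_module_def by blast
qed

lemma weight_space_eq:
  "weight_space scaleB scaleV act \<mu> =
    {v. \<forall>u. app (op (D u 0) 1) v = scaleV (\<Sum>i\<in>UNIV. u $ i * \<mu> $ i) v}"
  by (simp add: weight_space_def app_op[OF D_mem_SA])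

lemma nonzero_weight_space:
  assumes "weight_module scaleB scaleV act"
  shows "\<exists>\<mu>. weight_space scaleB scaleV act \<mu> \<noteq> {0}"
proof (rule ccontr)
  assume none: "\<nexists>\<mu>. weight_space scaleB scaleV act \<mu> \<noteq> {0}"
  have "v = 0" for v :: 'v
  proof -
    obtain w where w: "\<forall>\<mu>. w \<mu> \<in> weight_space scaleB scaleV act \<mu>" "v = (\<Sum>\<mu> | w \<mu> \<noteq> 0. w \<mu>)"
      using ex1_implies_ex[OF spec[OF assms[unfolded weight_module_def], of v]] by blast
    have "w \<mu> = 0" for \<mu> using none w(1) by blast
    then show ?thesis using w(2) by simp
  qed
  then have "(UNIV :: 'v set) = {0}" by auto
  then show False using irred by (simp add: irreducible_module_def)
qed

lemma weight_space_spanned: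
  assumes "uniformly_bounded scaleB scaleV act"
  obtains M where "\<And>\<mu>. \<exists>t. finite t \<and> card t \<le> M \<and> weight_space scaleB scaleV act \<mu> \<subseteq> V.span t"
proof -
  obtain M where M: "\<And>\<mu>. \<exists>S. finite S \<and> weight_space scaleB scaleV act \<mu> \<subseteq> V.span S"
      "\<And>\<mu>. V.dim (weight_space scaleB scaleV act \<mu>) \<le> M"
    using assms unfolding uniformly_bounded_def by blast
  show thesis
  proof (rule that)
    fix \<mu>
    obtain B where B: "B \<subseteq> weight_space scaleB scaleV act \<mu>" "V.independent B"
        "weight_space scaleB scaleV act \<mu> \<subseteq> V.span B"
        "card B = V.dim (weight_space scaleB scaleV act \<mu>)"
      by (rule V.basis_exists)
    obtain S where "finite S" "weight_space scaleB scaleV act \<mu> \<subseteq> V.span S" using M(1) by blast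
    then have "finite B" using V.independent_span_bound[OF _ B(2), of S] B(1) by auto
    then show "\<exists>t. finite t \<and> card t \<le> M \<and> weight_space scaleB scaleV act \<mu> \<subseteq> V.span t"
      using B(3,4) M(2) by (intro exI[of _ B]) simp
  qed
qed

end

theorem corollary3p15:
  fixes scaleB :: "complex \<Rightarrow> 'b::comm_ring_1 \<Rightarrow> 'b"
    and scaleV :: "complex \<Rightarrow> 'v::ab_group_add \<Rightarrow> 'v"
    and act :: "('n::finite, 'b) semidirect \<Rightarrow> 'v \<Rightarrow> 'v"
    and \<psi> :: "'b \<Rightarrow> complex"
  assumes "CARD('n) \<ge> 2"
    and "complex_comm_algebra scaleB"
    and "finitely_generated_algebra scaleB"
    and "SA_module scaleB scaleV act"
    and "irreducible_module scaleB scaleV act"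
    and "weight_module scaleB scaleV act"
    and "uniformly_bounded scaleB scaleV act"
    and "\<exists>v. act (tens scaleB (mono_A 0) 1) v \<noteq> 0"
    and "\<exists>s. s \<noteq> 0 \<and> (\<exists>v. act (tens scaleB (mono_A s) 1) v \<noteq> 0)"
    and "character scaleB \<psi>"
    and "\<forall>r b v. r \<noteq> 0 \<longrightarrow>
           act (tens scaleB (mono_A r) b) v = scaleV (\<psi> b) (act (tens scaleB (mono_A r) 1) v)"
  shows "\<forall>v b u r. r \<noteq> 0 \<and> pairing u r = 0 \<longrightarrow>
           act (tens scaleB (D u r) b) v = scaleV (\<psi> b) (act (tens scaleB (D u r) 1) v)"
proof -
  interpret A: complex_comm_algebra scaleB by fact
  interpret irreducible_SA_module scaleB scaleV act
    by unfold_locales fact+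
  obtain M where M:
      "\<And>\<mu>. \<exists>t. finite t \<and> card t \<le> M \<and> weight_space scaleB scaleV act \<mu> \<subseteq> V.span t"
    using weight_space_spanned[OF assms(7)] by blast
  interpret current_module scaleV scaleB "\<lambda>u r. op (D u r)" "\<lambda>r. op (mono_A r)" \<psi> M
    "weight_space scaleB scaleV act"
  proof (unfold_locales, goal_cases)
    case 1
    show ?case by fact
  next
    case (2 u r b)
    then show ?case by (simp add: lin_op D_mem_SA)
  next
    case (3 r b)
    show ?case by (simp add: lin_op mono_A_mem_SA)
  next
    case (4 u v r b)
    then show ?case by (simp add: D_add op_add D_mem_SA)
  next
    case (5 u r a b)
    then show ?case by (simp add: D_scale op_scale D_mem_SA)
  next
    case (6 u r b c)
    then show ?case by (simp add: op_add_right D_mem_SA)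
  next
    case (7 u r a b)
    then show ?case by (simp add: op_scale_right D_mem_SA)
  next
    case (8 u r v s b c)
    have "pairing (pairing u s *s v - pairing v r *s u) (r + s) = 0" using 8 by simp
    then have "bracket (D u r) (D v s) \<in> SA" unfolding bracket_D_D by (rule D_mem_SA)
    then show ?case using op_bracket[of "D u r" "D v s" b c] 8 by (simp add: D_mem_SA bracket_D_D)
  next
    case (9 u r s b c)
    have br: "bracket (D u r) (mono_A s) = scaleL (*) (pairing u s) (mono_A (r + s))"
      by (simp add: bracket_D_mono mono_A_scale)
    then have "bracket (D u r) (mono_A s) \<in> SA"
      using scaleL_mem_SA[OF mono_A_mem_SA] by simp
    then show ?case using op_bracket[of "D u r" "mono_A s" b c] 9
      by (simp add: D_mem_SA mono_A_mem_SA br op_scale)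
  next
    case (10 r s b c)
    have br: "bracket (mono_A r) (mono_A s) = 0" by (simp add: mono_A_def bracket_A_A)
    then have "bracket (mono_A r) (mono_A s) \<in> SA" using zero_mem_SA by simp
    then show ?case using op_bracket[of "mono_A r" "mono_A s" b c]
      by (simp add: mono_A_mem_SA br op_0)
  next
    case (11 r b)
    then have "act (tens scaleB (mono_A r) b) v = scaleV (\<psi> b) (act (tens scaleB (mono_A r) 1) v)" for v
      using assms(11) by blast
    then show ?case
      by (intro endo_eqI) (simp only: app_op[OF mono_A_mem_SA] app_mult V.app_Sc)
  next
    case 12
    show ?case by fact
  next
    case (13 \<mu>)
    show ?case by (rule weight_space_eq)
  next
    case (14 \<mu>)
    show ?case by (rule M)
  next
    case 15
    show ?case by (rule nonzero_weight_space[OF assms(6)])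
  next
    case 16
    obtain s v where "s \<noteq> 0" "act (tens scaleB (mono_A s) 1) v \<noteq> 0" using assms(9) by blast
    then have "app (op (mono_A s) 1) v \<noteq> 0" by (simp add: app_op mono_A_mem_SA)
    then have "op (mono_A s) 1 \<noteq> 0" by auto
    then show ?case using \<open>s \<noteq> 0\<close> by blast
  next
    case (17 W)
    then show ?case by (intro irreducible_generators)
  qed
  show ?thesis
  proof (intro allI impI, elim conjE)
    fix v b u r assume r: "(r :: int ^ 'n) \<noteq> 0" "pairing u r = 0"
    have "app (op (D u r) b) v = app (V.Sc (\<psi> b) * op (D u r) 1) v"
      using L_character[OF r, of b] by simp
    then show "act (tens scaleB (D u r) b) v = scaleV (\<psi> b) (act (tens scaleB (D u r) 1) v)"
      by (simp add: app_op D_mem_SA r(2))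
  qed
qed

end
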